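(* Let $A$ be an associative unital ring and let $\mathcal{C}$ be an $A$-coring which is finitely generated projective as a left $A$-module. Let ${}^*\mathcal{C}$ be the left dual ring of $\mathcal{C}$, let $i:A\to {}^*\mathcal{C}$, $i(a)(c)=\varepsilon(c)a$, be the associated ring morphism, and let ${}^*\mathcal{C}\otimes_A{}^*\mathcal{C}$ be the canonical ${}^*\mathcal{C}$-coring associated to $i$. Then the right dual $({}^*\mathcal{C}\otimes_A{}^*\mathcal{C})^*$ of this ${}^*\mathcal{C}$-coring is isomorphic, as a ring, to $\mathrm{End}({}_A\mathcal{C})^{op}$, the opposite of the ring (under composition) of left $A$-linear endomorphisms of $\mathcal{C}$.
   Context: Rings are associative with unit. For a ring $A$, an $A$-coring is an $A$-bimodule $\mathcal{C}$ with $A$-bimodule maps $\Delta:\mathcal{C}\to\mathcal{C}\otimes_A\mathcal{C}$, written $\Delta(c)=c_{(1)}\otimes c_{(2)}$ (summation understood), and $\varepsilon:\mathcal{C}\to A$, such that $\Delta$ is coassociative and $\varepsilon$ is a counit. The left dual of an $A$-coring $\mathcal{C}$ is ${}^*\mathcal{C}={}_A\mathrm{Hom}(\mathcal{C},A)$ (left $A$-linear maps), a ring with multiplication $(\phi*\psi)(c)=\psi(c_{(1)}\phi(c_{(2)}))$ and unit $\varepsilon$. The map $i:A\to{}^*\mathcal{C}$, $i(a)(c)=\varepsilon(c)a$, is a ring morphism, through which ${}^*\mathcal{C}$ is regarded as an $A$-bimodule. The right dual of an $A$-coring $\mathcal{C}$ is $\mathcal{C}^*=\mathrm{Hom}_A(\mathcal{C},A)$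 (right $A$-linear maps), a ring with multiplication $(\phi*\psi)(c)=\phi(\psi(c_{(1)})c_{(2)})$ and unit $\varepsilon$. For a ring morphism $B\to R$, the canonical coring associated to it is the $R$-coring $R\otimes_B R$ with comultiplication $\Delta(a\otimes b)=a\otimes 1\otimes b\in R\otimes_BR\otimes_BR\cong (R\otimes_BR)\otimes_R(R\otimes_BR)$ and counit $\varepsilon(a\otimes b)=ab$. *)

theory Defs
  imports "HOL-Algebra.Algebra"
begin

text \<open>
  The library locale \<^locale>\<open>module\<close> requires commutative scalars. Its record type and
  \<^locale>\<open>submodule\<close> are reused here over arbitrary rings. As in the library's own use of the
  record \<^type>\<open>module_ext\<close>, the fields \<open>mult\<close> and \<open>one\<close> of a module carry no meaning.
\<close>

record ('a, 'b, 'm) bimodule = "('a, 'm) module" +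
  rsmult :: "['m, 'b] \<Rightarrow> 'm" (infixl \<open>\<bullet>\<index>\<close> 70)

locale left_module = R?: ring R + M?: abelian_group M 
    for R :: "('a, 'e) ring_scheme" (structure) and M :: "('a, 'm, 'f) module_scheme" (structure) +
  assumes lsmult_closed:
      "\<lbrakk>a \<in> carrier R; x \<in> carrier M\<rbrakk> \<Longrightarrow> a \<odot>\<^bsub>M\<^esub> x \<in> carrier M"
    and lsmult_add_scalar:
      "\<lbrakk>a \<in> carrier R; b \<in> carrier R; x \<in> carrier M\<rbrakk>
        \<Longrightarrow> (a \<oplus>\<^bsub>R\<^esub> b) \<odot>\<^bsub>M\<^esub> x = a \<odot>\<^bsub>M\<^esub> x \<oplus>\<^bsub>M\<^esub> b \<odot>\<^bsub>M\<^esub> x"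
    and lsmult_add:
      "\<lbrakk>a \<in> carrier R; x \<in> carrier M; y \<in> carrier M\<rbrakk>
        \<Longrightarrow> a \<odot>\<^bsub>M\<^esub> (x \<oplus>\<^bsub>M\<^esub> y) = a \<odot>\<^bsub>M\<^esub> x \<oplus>\<^bsub>M\<^esub> a \<odot>\<^bsub>M\<^esub> y"
    and lsmult_assoc:
      "\<lbrakk>a \<in> carrier R; b \<in> carrier R; x \<in> carrier M\<rbrakk>
        \<Longrightarrow> (a \<otimes>\<^bsub>R\<^esub> b) \<odot>\<^bsub>M\<^esub> x = a \<odot>\<^bsub>M\<^esub> (b \<odot>\<^bsub>M\<^esub> x)"
    and lsmult_one: "x \<in> carrier M \<Longrightarrow> \<one>\<^bsub>R\<^esub> \<odot>\<^bsub>M\<^esub> x = x"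

locale bimodule = left_module R M + S?: ring S
    for R :: "('a, 'e) ring_scheme" (structure) and S :: "('b, 'g) ring_scheme" (structure)
      and M :: "('a, 'b, 'm, 'f) bimodule_scheme" (structure) +
  assumes rsmult_closed:
      "\<lbrakk>x \<in> carrier M; s \<in> carrier S\<rbrakk> \<Longrightarrow> x \<bullet>\<^bsub>M\<^esub> s \<in> carrier M"
    and rsmult_add_scalar:
      "\<lbrakk>x \<in> carrier M; s \<in> carrier S; t \<in> carrier S\<rbrakk>
        \<Longrightarrow> x \<bullet>\<^bsub>M\<^esub> (s \<oplus>\<^bsub>S\<^esub> t) = x \<bullet>\<^bsub>M\<^esub> s \<oplus>\<^bsub>M\<^esub> x \<bullet>\<^bsub>M\<^esub> t"
    and rsmult_add:
      "\<lbrakk>x \<in> carrier M; y \<in> carrier M; s \<in> carrier S\<rbrakk>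
        \<Longrightarrow> (x \<oplus>\<^bsub>M\<^esub> y) \<bullet>\<^bsub>M\<^esub> s = x \<bullet>\<^bsub>M\<^esub> s \<oplus>\<^bsub>M\<^esub> y \<bullet>\<^bsub>M\<^esub> s"
    and rsmult_assoc:
      "\<lbrakk>x \<in> carrier M; s \<in> carrier S; t \<in> carrier S\<rbrakk>
        \<Longrightarrow> x \<bullet>\<^bsub>M\<^esub> (s \<otimes>\<^bsub>S\<^esub> t) = (x \<bullet>\<^bsub>M\<^esub> s) \<bullet>\<^bsub>M\<^esub> t"
    and rsmult_one: "x \<in> carrier M \<Longrightarrow> x \<bullet>\<^bsub>M\<^esub> \<one>\<^bsub>S\<^esub> = x"
    and lsmult_rsmult:
      "\<lbrakk>a \<in> carrier R; x \<in> carrier M; s \<in> carrier S\<rbrakk>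
        \<Longrightarrow> (a \<odot>\<^bsub>M\<^esub> x) \<bullet>\<^bsub>M\<^esub> s = a \<odot>\<^bsub>M\<^esub> (x \<bullet>\<^bsub>M\<^esub> s)"

definition additive_map where
  "additive_map M N f \<longleftrightarrow> f \<in> carrier M \<rightarrow> carrier N \<and>
     (\<forall>x\<in>carrier M. \<forall>y\<in>carrier M. f (x \<oplus>\<^bsub>M\<^esub> y) = f x \<oplus>\<^bsub>N\<^esub> f y)"

definition left_linear where
  "left_linear R M N f \<longleftrightarrow> additive_map M N f \<and>
     (\<forall>a\<in>carrier R. \<forall>x\<in>carrier M. f (a \<odot>\<^bsub>M\<^esub> x) = a \<odot>\<^bsub>N\<^esub> f x)"

definition right_linear where
  "right_linear S M N f \<longleftrightarrow> additive_map M N f \<and>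
     (\<forall>x\<in>carrier M. \<forall>a\<in>carrier S. f (x \<bullet>\<^bsub>M\<^esub> a) = f x \<bullet>\<^bsub>N\<^esub> a)"

text \<open>Elements of Hom sets are taken extensional, so that each map is represented exactly once.\<close>

definition left_Hom where
  "left_Hom R M N = {f \<in> extensional (carrier M). left_linear R M N f}"

definition right_Hom where
  "right_Hom S M N = {f \<in> extensional (carrier M). right_linear S M N f}"

text \<open>The ring \<open>R\<close> as a bimodule, by restriction of scalars along \<open>f\<close> (left) and \<open>g\<close> (right).\<close>

definition ring_bimodule ::
    "('s \<Rightarrow> 'r) \<Rightarrow> ('t \<Rightarrow> 'r) \<Rightarrow> ('r, 'e) ring_scheme \<Rightarrow> ('s, 't, 'r) bimodule" where
  "ring_bimodule f g R =
     \<lparr>carrier = carrier R, monoid.mult = monoid.mult R, one = one R, ring.zero = ring.zero R, add = add R,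
      smult = (\<lambda>s x. f s \<otimes>\<^bsub>R\<^esub> x), rsmult = (\<lambda>x t. x \<otimes>\<^bsub>R\<^esub> g t)\<rparr>"

abbreviation regular_bimodule :: "('r, 'e) ring_scheme \<Rightarrow> ('r, 'r, 'r) bimodule" where
  "regular_bimodule R \<equiv> ring_bimodule (\<lambda>a. a) (\<lambda>a. a) R"


section \<open>Finitely generated and projective left modules\<close>

definition finitely_generated where
  "finitely_generated R M \<longleftrightarrow> (\<exists>Z. finite Z \<and> Z \<subseteq> carrier M \<and>
     (\<forall>m\<in>carrier M. \<exists>r\<in>Z \<rightarrow> carrier R. m = (\<Oplus>\<^bsub>M\<^esub>x\<in>Z. r x \<odot>\<^bsub>M\<^esub> x)))"

definition free_left_module ::
    "('a, 'e) ring_scheme \<Rightarrow> 'i set \<Rightarrow> ('a, 'i \<Rightarrow> 'a) module" where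
  "free_left_module R I =
     \<lparr>carrier = {v \<in> I \<rightarrow>\<^sub>E carrier R. finite {i \<in> I. v i \<noteq> \<zero>\<^bsub>R\<^esub>}},
      monoid.mult = undefined, one = undefined,
      ring.zero = (\<lambda>i\<in>I. \<zero>\<^bsub>R\<^esub>), add = (\<lambda>v w. \<lambda>i\<in>I. v i \<oplus>\<^bsub>R\<^esub> w i),
      smult = (\<lambda>a v. \<lambda>i\<in>I. a \<otimes>\<^bsub>R\<^esub> v i)\<rparr>"

definition direct_summand where
  "direct_summand R P F \<longleftrightarrow> submodule P R F \<and>
     (\<exists>Q. submodule Q R F \<and> P \<inter> Q = {\<zero>\<^bsub>F\<^esub>} \<and> (\<forall>x\<in>carrier F. \<exists>p\<in>P. \<exists>q\<in>Q. x = p \<oplus>\<^bsub>F\<^esub> q))"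

text \<open>
  Projective: isomorphic to a direct summand of a free module. Index sets drawn from the type of
  \<open>M\<close> are no restriction, since \<open>M\<close> is a quotient of the free module on \<^term>\<open>carrier M\<close>, and if
  \<open>M\<close> is projective that quotient map splits.
\<close>

definition projective_left_module ::
    "('a, 'e) ring_scheme \<Rightarrow> ('a, 'm, 'f) module_scheme \<Rightarrow> bool" where
  "projective_left_module R M \<longleftrightarrow> (\<exists>(I :: 'm set) P h.
     direct_summand R P (free_left_module R I) \<and>
     left_linear R M (free_left_module R I) h \<and> bij_betw h (carrier M) P)"


section \<open>Tensor products\<close>

definition tensor_relations where
  "tensor_relations A M N =
     {frag_of (m \<oplus>\<^bsub>M\<^esub> m', n) - frag_of (m, n) - frag_of (m', n) | m m' n.
        m \<in> carrier M \<and> m' \<in> carrier M \<and> n \<in> carrier N} \<union>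
     {frag_of (m, n \<oplus>\<^bsub>N\<^esub> n') - frag_of (m, n) - frag_of (m, n') | m n n'.
        m \<in> carrier M \<and> n \<in> carrier N \<and> n' \<in> carrier N} \<union>
     {frag_of (m \<bullet>\<^bsub>M\<^esub> a, n) - frag_of (m, a \<odot>\<^bsub>N\<^esub> n) | m a n.
        m \<in> carrier M \<and> a \<in> carrier A \<and> n \<in> carrier N}"

definition tensor_kernel where
  "tensor_kernel A M N =
     generate (free_Abelian_group (carrier M \<times> carrier N)) (tensor_relations A M N)"

definition tensor_group where
  "tensor_group A M N =
     free_Abelian_group (carrier M \<times> carrier N) Mod tensor_kernel A M N"

definition tens where
  "tens A M N m n =
     tensor_kernel A M N #>\<^bsub>free_Abelian_group (carrier M \<times> carrier N)\<^esub> frag_of (m, n)"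

text \<open>
  The additive map \<open>M \<otimes> N \<rightarrow> P\<close>, \<open>m \<otimes> n \<mapsto> f m n\<close>, induced by a balanced biadditive map \<open>f\<close>.
  The value at \<open>Z\<close> is the value of the extension of \<open>f\<close> to the free abelian group at any
  representative of the coset \<open>Z\<close> (they all agree when \<open>f\<close> is balanced and biadditive).
\<close>

definition tensor_lift ::
    "('p, 'e) ring_scheme \<Rightarrow> ('m \<Rightarrow> 'n \<Rightarrow> 'p) \<Rightarrow> ('m \<times> 'n \<Rightarrow>\<^sub>0 int) set \<Rightarrow> 'p" where
  "tensor_lift P f Z = the_elem ((\<lambda>x.
     \<Oplus>\<^bsub>P\<^esub>k\<in>Poly_Mapping.keys x. add_pow P (Poly_Mapping.lookup x k) (f (fst k) (snd k))) ` Z)"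

definition tensor_additive ::
    "('a, 'e) ring_scheme \<Rightarrow> ('r, 'a, 'm, 'f) bimodule_scheme \<Rightarrow> ('a, 's, 'n, 'g) bimodule_scheme
      \<Rightarrow> ('m \<times> 'n \<Rightarrow>\<^sub>0 int) set ring" where
  "tensor_additive A M N =
     \<lparr>carrier = carrier (tensor_group A M N), monoid.mult = undefined, one = undefined,
      ring.zero = \<one>\<^bsub>tensor_group A M N\<^esub>, add = monoid.mult (tensor_group A M N)\<rparr>"

definition tensor ::
    "('a, 'e) ring_scheme \<Rightarrow> ('r, 'a, 'm, 'f) bimodule_scheme \<Rightarrow> ('a, 's, 'n, 'g) bimodule_scheme
      \<Rightarrow> ('r, 's, ('m \<times> 'n \<Rightarrow>\<^sub>0 int) set) bimodule" where
  "tensor A M N =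
     \<lparr>carrier = carrier (tensor_group A M N), monoid.mult = undefined, one = undefined,
      ring.zero = \<one>\<^bsub>tensor_group A M N\<^esub>, add = monoid.mult (tensor_group A M N),
      smult = (\<lambda>r. tensor_lift (tensor_additive A M N) (\<lambda>m n. tens A M N (r \<odot>\<^bsub>M\<^esub> m) n)),
      rsmult = (\<lambda>x s. tensor_lift (tensor_additive A M N)
                        (\<lambda>m n. tens A M N m (n \<bullet>\<^bsub>N\<^esub> s)) x)\<rparr>"

definition tensor_map where
  "tensor_map A M' N' f g = tensor_lift (tensor A M' N') (\<lambda>m n. tens A M' N' (f m) (g n))"

text \<open>The associator \<open>(M \<otimes>\<^sub>A N) \<otimes>\<^sub>B P \<rightarrow> M \<otimes>\<^sub>A (N \<otimes>\<^sub>B P)\<close>.\<close>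

definition tensor_assoc where
  "tensor_assoc A B M N P =
     (let T = tensor A M (tensor B N P) in
        tensor_lift T (\<lambda>u p. tensor_lift T (\<lambda>m n. tens A M (tensor B N P) m (tens B N P n p)) u))"


section \<open>Corings and their dual rings\<close>

record ('a, 'c) coring = "('a, 'a, 'c) bimodule" +
  comult :: "'c \<Rightarrow> ('c \<times> 'c \<Rightarrow>\<^sub>0 int) set"
  counit :: "'c \<Rightarrow> 'a"

locale coring = bimodule A A C
    for A :: "('a, 'e) ring_scheme" and C :: "('a, 'c, 'f) coring_scheme" +
  assumes comult_left_linear: "left_linear A C (tensor A C C) (comult C)"
    and comult_right_linear: "right_linear A C (tensor A C C) (comult C)"
    and counit_left_linear: "left_linear A C (regular_bimodule A) (counit C)"
    and counit_right_linear: "right_linear A C (regular_bimodule A) (counit C)"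
    and coassociative: "c \<in> carrier C \<Longrightarrow>
      tensor_assoc A A C C C (tensor_map A (tensor A C C) C (comult C) (\<lambda>d. d) (comult C c)) =
      tensor_map A C (tensor A C C) (\<lambda>d. d) (comult C) (comult C c)"
    and counit_left: "c \<in> carrier C \<Longrightarrow>
      tensor_lift C (\<lambda>x y. counit C x \<odot>\<^bsub>C\<^esub> y) (comult C c) = c"
    and counit_right: "c \<in> carrier C \<Longrightarrow>
      tensor_lift C (\<lambda>x y. x \<bullet>\<^bsub>C\<^esub> counit C y) (comult C c) = c"

text \<open>
  In the two dual rings, \<^term>\<open>tensor_lift C f (comult C c)\<close> renders the Sweedler expression
  \<open>\<Sum> f c\<^sub>(\<^sub>1\<^sub>) c\<^sub>(\<^sub>2\<^sub>)\<close>.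
\<close>

definition left_dual :: "('a, 'e) ring_scheme \<Rightarrow> ('a, 'c, 'f) coring_scheme \<Rightarrow> ('c \<Rightarrow> 'a) ring" where
  "left_dual A C =
     \<lparr>carrier = left_Hom A C (regular_bimodule A),
      monoid.mult = (\<lambda>\<phi> \<psi>. \<lambda>c\<in>carrier C. \<psi> (tensor_lift C (\<lambda>x y. x \<bullet>\<^bsub>C\<^esub> \<phi> y) (comult C c))),
      one = restrict (counit C) (carrier C),
      ring.zero = (\<lambda>c\<in>carrier C. \<zero>\<^bsub>A\<^esub>),
      add = (\<lambda>\<phi> \<psi>. \<lambda>c\<in>carrier C. \<phi> c \<oplus>\<^bsub>A\<^esub> \<psi> c)\<rparr>"

definition left_dual_map ::
    "('a, 'e) ring_scheme \<Rightarrow> ('a, 'c, 'f) coring_scheme \<Rightarrow> 'a \<Rightarrow> 'c \<Rightarrow> 'a" where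
  "left_dual_map A C a = (\<lambda>c\<in>carrier C. counit C c \<otimes>\<^bsub>A\<^esub> a)"

definition right_dual :: "('a, 'e) ring_scheme \<Rightarrow> ('a, 'c, 'f) coring_scheme \<Rightarrow> ('c \<Rightarrow> 'a) ring" where
  "right_dual A C =
     \<lparr>carrier = right_Hom A C (regular_bimodule A),
      monoid.mult = (\<lambda>\<phi> \<psi>. \<lambda>c\<in>carrier C. \<phi> (tensor_lift C (\<lambda>x y. \<psi> x \<odot>\<^bsub>C\<^esub> y) (comult C c))),
      one = restrict (counit C) (carrier C),
      ring.zero = (\<lambda>c\<in>carrier C. \<zero>\<^bsub>A\<^esub>),
      add = (\<lambda>\<phi> \<psi>. \<lambda>c\<in>carrier C. \<phi> c \<oplus>\<^bsub>A\<^esub> \<psi> c)\<rparr>"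

text \<open>
  The canonical coring of a ring morphism \<open>f : B \<rightarrow> R\<close>. Under the identification
  \<open>R \<otimes>\<^sub>B R \<otimes>\<^sub>B R \<cong> (R \<otimes>\<^sub>B R) \<otimes>\<^sub>R (R \<otimes>\<^sub>B R)\<close> the element \<open>a \<otimes> 1 \<otimes> b\<close> is
  \<open>(a \<otimes> 1) \<otimes> (1 \<otimes> b)\<close>.
\<close>

definition canonical_tensor ::
    "('b, 'e) ring_scheme \<Rightarrow> ('b \<Rightarrow> 'r) \<Rightarrow> ('r, 'f) ring_scheme
      \<Rightarrow> ('r, 'r, ('r \<times> 'r \<Rightarrow>\<^sub>0 int) set) bimodule" where
  "canonical_tensor B f R =
     tensor B (ring_bimodule (\<lambda>r. r) f R) (ring_bimodule f (\<lambda>r. r) R)"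

definition canonical_tens ::
    "('b, 'e) ring_scheme \<Rightarrow> ('b \<Rightarrow> 'r) \<Rightarrow> ('r, 'f) ring_scheme
      \<Rightarrow> 'r \<Rightarrow> 'r \<Rightarrow> ('r \<times> 'r \<Rightarrow>\<^sub>0 int) set" where
  "canonical_tens B f R =
     tens B (ring_bimodule (\<lambda>r. r) f R) (ring_bimodule f (\<lambda>r. r) R)"

definition canonical_coring ::
    "('b, 'e) ring_scheme \<Rightarrow> ('b \<Rightarrow> 'r) \<Rightarrow> ('r, 'f) ring_scheme
      \<Rightarrow> ('r, ('r \<times> 'r \<Rightarrow>\<^sub>0 int) set) coring" where
  "canonical_coring B f R =
     (let T = canonical_tensor B f R in
        \<lparr>carrier = carrier T, monoid.mult = undefined, one = undefined,
         ring.zero = \<zero>\<^bsub>T\<^esub>, add = add T, smult = smult T, rsmult = rsmult T,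
         comult = tensor_lift (tensor R T T)
           (\<lambda>a b. tens R T T (canonical_tens B f R a \<one>\<^bsub>R\<^esub>) (canonical_tens B f R \<one>\<^bsub>R\<^esub> b)),
         counit = tensor_lift R (\<lambda>a b. a \<otimes>\<^bsub>R\<^esub> b)\<rparr>)"

definition left_End :: "('a, 'e) ring_scheme \<Rightarrow> ('a, 'm, 'f) module_scheme \<Rightarrow> ('m \<Rightarrow> 'm) ring" where
  "left_End R M =
     \<lparr>carrier = left_Hom R M M,
      monoid.mult = compose (carrier M),
      one = (\<lambda>x\<in>carrier M. x),
      ring.zero = (\<lambda>x\<in>carrier M. \<zero>\<^bsub>M\<^esub>),
      add = (\<lambda>f g. \<lambda>x\<in>carrier M. f x \<oplus>\<^bsub>M\<^esub> g x)\<rparr>"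

definition opposite_ring :: "('a, 'e) ring_scheme \<Rightarrow> ('a, 'e) ring_scheme" where
  "opposite_ring R = R\<lparr>monoid.mult := (\<lambda>x y. y \<otimes>\<^bsub>R\<^esub> x)\<rparr>"

end

theory Submission
  imports Defs
begin

text \<open>
  Write \<open>R\<close> for the left dual of \<open>C\<close> and \<open>i : A \<rightarrow> R\<close> for its structure map. The isomorphism is the composite of
  two classical ones.

  A right \<open>R\<close>-linear map \<open>\<Phi> : R \<otimes>\<^sub>A R \<rightarrow> R\<close> is the same as the right \<open>A\<close>-linear map \<open>r \<mapsto> \<Phi>(r \<otimes> 1)\<close> on \<open>R\<close>.
  The comultiplication \<open>a \<otimes> b \<mapsto> (a \<otimes> 1) \<otimes> (1 \<otimes> b)\<close> turns the product of the right dual into composition, so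
  the right dual is the ring \<open>End(R\<^sub>A)\<close>. This holds for every ring morphism, and the locale
  \<open>ring_extension\<close> proves it in that generality.

  Because \<open>C\<close> is finitely generated projective on the left, it has a finite dual basis \<open>(e\<^sub>j, \<xi>\<^sub>j)\<close>, so duality
  identifies the endomorphisms of \<open>C\<close> with those of \<open>R\<close>: a left \<open>A\<close>-linear \<open>g\<close> corresponds to \<open>\<phi> \<mapsto> \<phi> \<circ> g\<close>.
  This reverses composition, which accounts for the opposite ring. In the direction needed here, \<open>\<Phi>\<close> goes to
  the endomorphism \<open>c \<mapsto> \<Sum>\<^sub>j \<Phi>(\<xi>\<^sub>j \<otimes> 1)(c) e\<^sub>j\<close>, characterised by \<open>\<phi>(g c) = \<Phi>(\<phi> \<otimes> 1)(c)\<close> for all \<open>\<phi>\<close> in \<open>R\<close>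
  (lemma \<open>functional_dual_to_End\<close>). As the functionals in \<open>R\<close> separate the points of \<open>C\<close>, all properties of the
  isomorphism follow from this one equation.

  The groundwork is the universal property of the tensor product, its bimodule structure, and the fact that \<open>R\<close>
  is a ring, whose associativity is coassociativity of \<open>C\<close>.
\<close>

section \<open>Additive and balanced maps\<close>

text \<open>
  The maps out of \<open>M \<times> N\<close> that factor through \<open>M \<otimes>\<^sub>A N\<close>.
\<close>
definition balanced where
  "balanced A M N P f \<longleftrightarrow>
     (\<forall>m\<in>carrier M. \<forall>n\<in>carrier N. f m n \<in> carrier P) \<and>
     (\<forall>m\<in>carrier M. \<forall>m'\<in>carrier M. \<forall>n\<in>carrier N.
        f (m \<oplus>\<^bsub>M\<^esub> m') n = f m n \<oplus>\<^bsub>P\<^esub> f m' n) \<and>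
     (\<forall>m\<in>carrier M. \<forall>n\<in>carrier N. \<forall>n'\<in>carrier N.
        f m (n \<oplus>\<^bsub>N\<^esub> n') = f m n \<oplus>\<^bsub>P\<^esub> f m n') \<and>
     (\<forall>m\<in>carrier M. \<forall>a\<in>carrier A. \<forall>n\<in>carrier N.
        f (m \<bullet>\<^bsub>M\<^esub> a) n = f m (a \<odot>\<^bsub>N\<^esub> n))"

lemma balancedI:
  assumes "\<And>m n. \<lbrakk>m \<in> carrier M; n \<in> carrier N\<rbrakk> \<Longrightarrow> f m n \<in> carrier P"
    and "\<And>m m' n. \<lbrakk>m \<in> carrier M; m' \<in> carrier M; n \<in> carrier N\<rbrakk>
           \<Longrightarrow> f (m \<oplus>\<^bsub>M\<^esub> m') n = f m n \<oplus>\<^bsub>P\<^esub> f m' n"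
    and "\<And>m n n'. \<lbrakk>m \<in> carrier M; n \<in> carrier N; n' \<in> carrier N\<rbrakk>
           \<Longrightarrow> f m (n \<oplus>\<^bsub>N\<^esub> n') = f m n \<oplus>\<^bsub>P\<^esub> f m n'"
    and "\<And>m a n. \<lbrakk>m \<in> carrier M; a \<in> carrier A; n \<in> carrier N\<rbrakk>
           \<Longrightarrow> f (m \<bullet>\<^bsub>M\<^esub> a) n = f m (a \<odot>\<^bsub>N\<^esub> n)"
  shows "balanced A M N P f"
  using assms unfolding balanced_def by simp

lemma additive_mapI:
  assumes "\<And>x. x \<in> carrier M \<Longrightarrow> f x \<in> carrier N"
    and "\<And>x y. \<lbrakk>x \<in> carrier M; y \<in> carrier M\<rbrakk> \<Longrightarrow> f (x \<oplus>\<^bsub>M\<^esub> y) = f x \<oplus>\<^bsub>N\<^esub> f y"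
  shows "additive_map M N f"
  using assms unfolding additive_map_def by auto

lemma additive_mapD:
  assumes "additive_map M N f"
  shows "x \<in> carrier M \<Longrightarrow> f x \<in> carrier N"
    and "\<lbrakk>x \<in> carrier M; y \<in> carrier M\<rbrakk> \<Longrightarrow> f (x \<oplus>\<^bsub>M\<^esub> y) = f x \<oplus>\<^bsub>N\<^esub> f y"
  using assms unfolding additive_map_def by auto

lemma additive_map_compose:
  "\<lbrakk>additive_map M N f; additive_map N P g\<rbrakk> \<Longrightarrow> additive_map M P (\<lambda>x. g (f x))"
  by (auto simp: additive_map_def Pi_iff)

lemma additive_map_id: "additive_map M M (\<lambda>x. x)"
  by (auto simp: additive_map_def)

lemma additive_map_add:
  assumes "abelian_group N" "additive_map M N f" "additive_map M N g"
  shows "additive_map M N (\<lambda>x. f x \<oplus>\<^bsub>N\<^esub> g x)"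
proof -
  interpret abelian_group N by fact
  show ?thesis
    using assms(2,3) by (auto simp: additive_map_def Pi_iff a_ac)
qed

lemma additive_map_hom:
  assumes "abelian_group M" "abelian_group N" "additive_map M N f"
  shows "group_hom (add_monoid M) (add_monoid N) f"
proof -
  interpret M: abelian_group M by fact
  interpret N: abelian_group N by fact
  show ?thesis
    using assms(3) unfolding group_hom_def group_hom_axioms_def hom_def additive_map_def
    by (auto simp: M.a_group N.a_group)
qed

lemma additive_map_zero:
  assumes "abelian_group M" "abelian_group N" "additive_map M N f"
  shows "f \<zero>\<^bsub>M\<^esub> = \<zero>\<^bsub>N\<^esub>"
  using group_hom.hom_one[OF additive_map_hom[OF assms]] by simp

lemma additive_map_minus:
  assumes "abelian_group M" "abelian_group N" "additive_map M N f" "x \<in> carrier M"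
  shows "f (\<ominus>\<^bsub>M\<^esub> x) = \<ominus>\<^bsub>N\<^esub> f x"
  using group_hom.hom_inv[OF additive_map_hom[OF assms(1-3)]] assms(4) by (simp add: a_inv_def)

lemma additive_map_finsum:
  assumes M: "abelian_group M" and N: "abelian_group N" and f: "additive_map M N f"
    and "finite I" "g \<in> I \<rightarrow> carrier M"
  shows "f (\<Oplus>\<^bsub>M\<^esub>i\<in>I. g i) = (\<Oplus>\<^bsub>N\<^esub>i\<in>I. f (g i))"
proof -
  interpret M: abelian_group M by fact
  interpret N: abelian_group N by fact
  show ?thesis
    using \<open>finite I\<close> \<open>g \<in> I \<rightarrow> carrier M\<close>
  proof (induction I rule: finite_induct)
    case empty
    then show ?case
      by (simp add: additive_map_zero[OF M N f])
  next
    case (insert i I)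
    then have "f (finsum M g (insert i I)) = f (g i \<oplus>\<^bsub>M\<^esub> finsum M g I)"
      by (simp add: Pi_iff)
    also have "\<dots> = f (g i) \<oplus>\<^bsub>N\<^esub> f (finsum M g I)"
      using insert by (intro additive_mapD(2)[OF f]) (auto simp: Pi_iff)
    finally show ?case
      using insert additive_mapD(1)[OF f] by (simp add: Pi_iff)
  qed
qed

text \<open>
  The lift reads only the additive part of the target record. This is what identifies the lifts into
  \<^const>\<open>tensor_additive\<close>, \<^const>\<open>tensor\<close> and \<^const>\<open>canonical_coring\<close>, which are different
  records over one additive group.
\<close>
lemma tensor_lift_cong_additive:
  fixes f :: "'m \<Rightarrow> 'n \<Rightarrow> 'p"
  assumes "carrier P = carrier Q" "add P = add Q" "\<zero>\<^bsub>P\<^esub> = \<zero>\<^bsub>Q\<^esub>"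
  shows "tensor_lift P f = tensor_lift Q f"
proof -
  have "finsum P = (finsum Q :: ('m \<times> 'n \<Rightarrow> 'p) \<Rightarrow> _)"
    using assms unfolding finsum_def finprod_def[abs_def] by (simp cong: if_cong)
  moreover have "add_pow P = (add_pow Q :: int \<Rightarrow> 'p \<Rightarrow> 'p)"
    using assms unfolding add_pow_def[abs_def] int_pow_def nat_pow_def m_inv_def[abs_def] by (simp cong: if_cong)
  ultimately show ?thesis
    unfolding tensor_lift_def[abs_def] by simp
qed

section \<open>Universal property and bimodule structure of the tensor product\<close>

locale tensor_product = left: bimodule R A M + right: bimodule A S N
  for R :: "('r, 'e) ring_scheme" and A :: "('a, 'f) ring_scheme" and S :: "('s, 'g) ring_scheme"
    and M :: "('r, 'a, 'm, 'h) bimodule_scheme" and N :: "('a, 's, 'n, 'k) bimodule_scheme"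
begin

abbreviation "FA \<equiv> free_Abelian_group (carrier M \<times> carrier N)"
abbreviation "K \<equiv> tensor_kernel A M N"
abbreviation "T \<equiv> tensor A M N"
abbreviation "t \<equiv> tens A M N"

lemma carrier_T: "carrier T = carrier (tensor_group A M N)"
  and add_T: "add T = monoid.mult (tensor_group A M N)"
  and zero_T: "\<zero>\<^bsub>T\<^esub> = \<one>\<^bsub>tensor_group A M N\<^esub>"
  by (simp_all add: tensor_def)

sublocale FA: comm_group FA
  by (rule abelian_free_Abelian_group)

lemma relations_subset: "tensor_relations A M N \<subseteq> carrier FA"
proof -
  have diff: "x - y \<in> carrier FA" if "x \<in> carrier FA" "y \<in> carrier FA" for x y
    using that FA.m_closed[of x "- y"] by simp
  show ?thesis
    unfolding tensor_relations_def
    by (auto simp del: carrier_free_Abelian_group_iff intro!: diff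
        simp: left.rsmult_closed right.lsmult_closed)
qed

lemma kernel_normal: "K \<lhd> FA"
  unfolding tensor_kernel_def
  by (rule FA.subgroup_imp_normal[OF FA.generate_is_subgroup[OF relations_subset]])

lemma comm_group_tensor_group: "comm_group (tensor_group A M N)"
  unfolding tensor_group_def
  by (rule FA.abelian_FactGroup) (use kernel_normal in \<open>simp add: normal_imp_subgroup\<close>)

lemma abelian_group_T: "abelian_group T"
proof -
  interpret comm_group "tensor_group A M N" by (rule comm_group_tensor_group)
  show ?thesis
    by (rule abelian_groupI) (auto simp: carrier_T add_T zero_T m_ac intro: l_inv_ex)
qed

sublocale T: abelian_group T
  by (rule abelian_group_T)

lemma coset_in_T: "x \<in> carrier FA \<Longrightarrow> K #>\<^bsub>FA\<^esub> x \<in> carrier T"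
  by (auto simp: carrier_T tensor_group_def FactGroup_def RCOSETS_def)

lemma T_cosetE:
  assumes "z \<in> carrier T"
  obtains x where "x \<in> carrier FA" "z = K #>\<^bsub>FA\<^esub> x"
  using assms by (auto simp: carrier_T tensor_group_def FactGroup_def RCOSETS_def)

lemma coset_add:
  assumes "x \<in> carrier FA" "y \<in> carrier FA"
  shows "(K #>\<^bsub>FA\<^esub> x) \<oplus>\<^bsub>T\<^esub> (K #>\<^bsub>FA\<^esub> y) = K #>\<^bsub>FA\<^esub> (x + y)"
  using normal.rcos_sum[OF kernel_normal assms]
  by (simp add: add_T tensor_group_def FactGroup_def)

lemma coset_hom: "(\<lambda>x. K #>\<^bsub>FA\<^esub> x) \<in> hom FA (add_monoid T)"
  using coset_in_T coset_add by (auto intro!: homI)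

lemma coset_diff_in_kernel:
  assumes "x \<in> carrier FA" "y \<in> carrier FA" "x - y \<in> K"
  shows "K #>\<^bsub>FA\<^esub> x = K #>\<^bsub>FA\<^esub> y"
proof -
  interpret K: normal K FA by (rule kernel_normal)
  have "x = (x - y) \<otimes>\<^bsub>FA\<^esub> y" by simp
  then have "x \<in> K #>\<^bsub>FA\<^esub> y"
    using assms(3) unfolding r_coset_def by blast
  then show ?thesis
    using FA.repr_independence[OF _ assms(2) K.is_subgroup] by simp
qed

lemma relation_in_kernel: "x \<in> tensor_relations A M N \<Longrightarrow> x \<in> K"
  unfolding tensor_kernel_def by (rule generate.incl)

lemma tens_closed [intro, simp]: "\<lbrakk>m \<in> carrier M; n \<in> carrier N\<rbrakk> \<Longrightarrow> t m n \<in> carrier T"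
  unfolding tens_def by (rule coset_in_T) simp

lemma tens_add_left:
  assumes "m \<in> carrier M" "m' \<in> carrier M" "n \<in> carrier N"
  shows "t (m \<oplus>\<^bsub>M\<^esub> m') n = t m n \<oplus>\<^bsub>T\<^esub> t m' n"
proof -
  have cl: "frag_of (m, n) + frag_of (m', n) \<in> carrier FA"
    using FA.m_closed[of "frag_of (m, n)" "frag_of (m', n)"] assms
    by (simp del: carrier_free_Abelian_group_iff add: frag_of_in_free_Abelian_group)
  have "frag_of (m \<oplus>\<^bsub>M\<^esub> m', n) - (frag_of (m, n) + frag_of (m', n)) \<in> K"
    by (rule relation_in_kernel) (use assms in \<open>auto simp: tensor_relations_def diff_diff_add\<close>)
  then have "K #>\<^bsub>FA\<^esub> frag_of (m \<oplus>\<^bsub>M\<^esub> m', n) = K #>\<^bsub>FA\<^esub> (frag_of (m, n) + frag_of (m', n))"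
    using assms cl
    by (intro coset_diff_in_kernel) (simp_all del: carrier_free_Abelian_group_iff)
  then show ?thesis
    using assms by (simp add: tens_def coset_add del: carrier_free_Abelian_group_iff)
qed

lemma tens_add_right:
  assumes "m \<in> carrier M" "n \<in> carrier N" "n' \<in> carrier N"
  shows "t m (n \<oplus>\<^bsub>N\<^esub> n') = t m n \<oplus>\<^bsub>T\<^esub> t m n'"
proof -
  have cl: "frag_of (m, n) + frag_of (m, n') \<in> carrier FA"
    using FA.m_closed[of "frag_of (m, n)" "frag_of (m, n')"] assms
    by (simp del: carrier_free_Abelian_group_iff add: frag_of_in_free_Abelian_group)
  have "frag_of (m, n \<oplus>\<^bsub>N\<^esub> n') - (frag_of (m, n) + frag_of (m, n')) \<in> K"
    by (rule relation_in_kernel) (use assms in \<open>auto simp: tensor_relations_def diff_diff_add\<close>)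
  then have "K #>\<^bsub>FA\<^esub> frag_of (m, n \<oplus>\<^bsub>N\<^esub> n') = K #>\<^bsub>FA\<^esub> (frag_of (m, n) + frag_of (m, n'))"
    using assms cl
    by (intro coset_diff_in_kernel) (simp_all del: carrier_free_Abelian_group_iff)
  then show ?thesis
    using assms by (simp add: tens_def coset_add del: carrier_free_Abelian_group_iff)
qed

lemma tens_balance:
  assumes "m \<in> carrier M" "a \<in> carrier A" "n \<in> carrier N"
  shows "t (m \<bullet>\<^bsub>M\<^esub> a) n = t m (a \<odot>\<^bsub>N\<^esub> n)"
proof -
  have "frag_of (m \<bullet>\<^bsub>M\<^esub> a, n) - frag_of (m, a \<odot>\<^bsub>N\<^esub> n) \<in> K"
    by (rule relation_in_kernel) (use assms in \<open>auto simp: tensor_relations_def\<close>)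
  then show ?thesis
    unfolding tens_def using assms
    by (intro coset_diff_in_kernel)
      (simp_all add: left.rsmult_closed right.lsmult_closed del: carrier_free_Abelian_group_iff)
qed

text \<open>
  The universal property, on the level of cosets. A balanced map extends to a homomorphism \<open>h\<close> on the
  free abelian group that kills the defining relations, hence the whole kernel. So \<open>h\<close> is constant on each
  coset, and its value there is the one that \<^const>\<open>tensor_lift\<close> computes from any representative.
\<close>
lemma tensor_lift_hom:
  assumes "abelian_group P" "balanced A M N P f"
  obtains h where "h \<in> hom FA (add_monoid P)"
    "\<And>m n. \<lbrakk>m \<in> carrier M; n \<in> carrier N\<rbrakk> \<Longrightarrow> h (frag_of (m, n)) = f m n"
    "\<And>x. x \<in> carrier FA \<Longrightarrow> tensor_lift P f (K #>\<^bsub>FA\<^esub> x) = h x"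
proof -
  interpret P: abelian_group P by fact
  have f: "f m n \<in> carrier P" if "m \<in> carrier M" "n \<in> carrier N" for m n
    using assms(2) that by (auto simp: balanced_def)
  have "(\<lambda>(m, n). f m n) ` (carrier M \<times> carrier N) \<subseteq> carrier (add_monoid P)"
    using f by auto
  then obtain h where h: "h \<in> hom FA (add_monoid P)"
    and h_of: "\<And>x. x \<in> carrier M \<times> carrier N \<Longrightarrow> h (frag_of x) = (case x of (m, n) \<Rightarrow> f m n)"
    using comm_group.free_Abelian_group_universal[OF P.a_comm_group] by blast
  interpret h: group_hom FA "add_monoid P" h
    by (simp add: group_hom_def group_hom_axioms_def FA.is_group P.a_group h)
  have sum: "(\<Sum>k\<in>I. frag_cmul (l k) (frag_of k)) \<in> carrier FA \<and>
      h (\<Sum>k\<in>I. frag_cmul (l k) (frag_of k)) =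
        (\<Oplus>\<^bsub>P\<^esub>k\<in>I. add_pow P (l k) (f (fst k) (snd k)))"
    if "finite I" "I \<subseteq> carrier M \<times> carrier N" for I and l :: "'m \<times> 'n \<Rightarrow> int"
    using that
  proof (induction I rule: finite_induct)
    case empty
    then show ?case using h.hom_one by simp
  next
    case (insert k I)
    let ?s = "\<lambda>I. \<Sum>k\<in>I. frag_cmul (l k) (frag_of k)"
    have k: "frag_of k \<in> carrier FA" "frag_cmul (l k) (frag_of k) \<in> carrier FA"
      using insert.prems keys_cmul[of "l k" "frag_of k"] by (auto simp: keys_frag_of)
    have IH: "?s I \<in> carrier FA" "h (?s I) = (\<Oplus>\<^bsub>P\<^esub>k\<in>I. add_pow P (l k) (f (fst k) (snd k)))"
      using insert by auto
    have "h (frag_cmul (l k) (frag_of k)) = add_pow P (l k) (f (fst k) (snd k))"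
      using h.hom_int_pow[OF k(1), of "l k"] k(1) insert.prems h_of[of k]
      by (auto simp: add_pow_def)
    moreover have "h (?s (insert k I)) = h (frag_cmul (l k) (frag_of k)) \<oplus>\<^bsub>P\<^esub> h (?s I)"
      using h.hom_mult[OF k(2) IH(1)] insert by simp
    moreover have "?s (insert k I) \<in> carrier FA"
      using FA.m_closed[OF k(2) IH(1)] insert by simp
    moreover have "(\<lambda>k. add_pow P (l k) (f (fst k) (snd k))) \<in> insert k I \<rightarrow> carrier P"
      using insert.prems f by (auto simp: P.add.int_pow_closed)
    ultimately show ?case
      using insert IH(2) by (simp add: Pi_iff del: carrier_free_Abelian_group_iff)
  qed
  have ext: "(\<Oplus>\<^bsub>P\<^esub>k\<in>Poly_Mapping.keys x. add_pow P (Poly_Mapping.lookup x k) (f (fst k) (snd k))) = h x"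
    if "x \<in> carrier FA" for x
    using sum[of "Poly_Mapping.keys x" "Poly_Mapping.lookup x"] that
      frag_expansion[of x, symmetric] by (simp add: frag_extend_def)
  have ker: "h k = \<zero>\<^bsub>P\<^esub>" if "k \<in> K" for k
  proof -
    have diff: "h (x - y) = h x \<ominus>\<^bsub>P\<^esub> h y" if "x \<in> carrier FA" "y \<in> carrier FA" for x y
      using h.hom_mult[of x "- y"] h.hom_inv[of y] that FA.inv_closed[of y]
      by (simp add: a_minus_def a_inv_def)
    have zero: "h (x - y) = \<zero>\<^bsub>P\<^esub>"
      if "x \<in> carrier FA" "y \<in> carrier FA" "h x = h y" for x y
      using that h.hom_closed[of y] by (simp add: diff P.r_neg a_minus_def del: carrier_free_Abelian_group_iff)
    have zero': "h (x - y - z) = \<zero>\<^bsub>P\<^esub>"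
      if x: "x \<in> carrier FA" and y: "y \<in> carrier FA" and z: "z \<in> carrier FA"
        and eq: "h x = h y \<oplus>\<^bsub>P\<^esub> h z" for x y z
    proof -
      have "y + z \<in> carrier FA"
        using FA.m_closed[OF y z] by (simp only: mult_free_Abelian_group)
      moreover have "h x = h (y + z)"
        using h.hom_mult[OF y z] eq by (simp only: mult_free_Abelian_group monoid.select_convs)
      ultimately have "h (x - (y + z)) = \<zero>\<^bsub>P\<^esub>"
        by (rule zero[OF x])
      then show ?thesis
        by (simp only: diff_diff_add)
    qed
    have "h x = \<zero>\<^bsub>P\<^esub>" if "x \<in> tensor_relations A M N" for x
    proof -
      note bal = assms(2)[unfolded balanced_def]
      from that consider
          (add_left) m m' n where "x = frag_of (m \<oplus>\<^bsub>M\<^esub> m', n) - frag_of (m, n) - frag_of (m', n)"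
            "m \<in> carrier M" "m' \<in> carrier M" "n \<in> carrier N"
        | (add_right) m n n' where "x = frag_of (m, n \<oplus>\<^bsub>N\<^esub> n') - frag_of (m, n) - frag_of (m, n')"
            "m \<in> carrier M" "n \<in> carrier N" "n' \<in> carrier N"
        | (balance) m a n where "x = frag_of (m \<bullet>\<^bsub>M\<^esub> a, n) - frag_of (m, a \<odot>\<^bsub>N\<^esub> n)"
            "m \<in> carrier M" "a \<in> carrier A" "n \<in> carrier N"
        unfolding tensor_relations_def by blast
      then show ?thesis
      proof cases
        case add_left
        have "h (frag_of (m \<oplus>\<^bsub>M\<^esub> m', n)) = h (frag_of (m, n)) \<oplus>\<^bsub>P\<^esub> h (frag_of (m', n))"
          using add_left(2-4) bal by (simp add: h_of)
        then show ?thesis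
          unfolding add_left(1) using add_left(2-4)
          by (intro zero') (simp_all only: frag_of_in_free_Abelian_group mem_Times_iff fst_conv snd_conv left.M.a_closed)
      next
        case add_right
        have "h (frag_of (m, n \<oplus>\<^bsub>N\<^esub> n')) = h (frag_of (m, n)) \<oplus>\<^bsub>P\<^esub> h (frag_of (m, n'))"
          using add_right(2-4) bal by (simp add: h_of)
        then show ?thesis
          unfolding add_right(1) using add_right(2-4)
          by (intro zero') (simp_all only: frag_of_in_free_Abelian_group mem_Times_iff fst_conv snd_conv right.M.a_closed)
      next
        case balance
        have "h (frag_of (m \<bullet>\<^bsub>M\<^esub> a, n)) = h (frag_of (m, a \<odot>\<^bsub>N\<^esub> n))"
          using balance(2-4) bal by (simp add: h_of left.rsmult_closed right.lsmult_closed)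
        then show ?thesis
          unfolding balance(1) using balance(2-4)
          by (intro zero) (simp_all only: frag_of_in_free_Abelian_group mem_Times_iff fst_conv snd_conv
              left.rsmult_closed right.lsmult_closed)
      qed
    qed
    then have "tensor_relations A M N \<subseteq> kernel FA (add_monoid P) h"
      using relations_subset by (auto simp: kernel_def simp del: carrier_free_Abelian_group_iff)
    then have "K \<subseteq> kernel FA (add_monoid P) h"
      unfolding tensor_kernel_def by (rule FA.generate_subgroup_incl[OF _ h.subgroup_kernel])
    then show ?thesis
      using that by (auto simp: kernel_def)
  qed
  have lift: "tensor_lift P f (K #>\<^bsub>FA\<^esub> x) = h x" if x: "x \<in> carrier FA" for x
  proof -
    interpret K: normal K FA by (rule kernel_normal)
    have "(\<Oplus>\<^bsub>P\<^esub>k\<in>Poly_Mapping.keys y. add_pow P (Poly_Mapping.lookup y k) (f (fst k) (snd k))) = h x"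
      if y: "y \<in> K #>\<^bsub>FA\<^esub> x" for y
    proof -
      obtain k where k: "k \<in> K" and y': "y = k \<otimes>\<^bsub>FA\<^esub> x"
        using y unfolding r_coset_def by blast
      have kF: "k \<in> carrier FA"
        using k K.subset by blast
      have "h y = \<zero>\<^bsub>P\<^esub> \<oplus>\<^bsub>P\<^esub> h x"
        using h.hom_mult[OF kF x] ker[OF k] by (simp only: y' monoid.select_convs)
      moreover have "y \<in> carrier FA"
        unfolding y' by (rule FA.m_closed[OF kF x])
      ultimately show ?thesis
        using ext h.hom_closed[OF x] by simp
    qed
    moreover have "K #>\<^bsub>FA\<^esub> x \<noteq> {}"
      using FA.rcos_self[OF x K.is_subgroup] by blast
    ultimately show ?thesis
      unfolding tensor_lift_def by (simp add: image_constant_conv cong: image_cong_simp)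
  qed
  show thesis
    by (rule that[OF h _ lift]) (auto simp: h_of)
qed

lemma tensor_lift_tens:
  assumes "abelian_group P" "balanced A M N P f" "m \<in> carrier M" "n \<in> carrier N"
  shows "tensor_lift P f (t m n) = f m n"
proof -
  obtain h where "\<And>m n. \<lbrakk>m \<in> carrier M; n \<in> carrier N\<rbrakk> \<Longrightarrow> h (frag_of (m, n)) = f m n"
    "\<And>x. x \<in> carrier FA \<Longrightarrow> tensor_lift P f (K #>\<^bsub>FA\<^esub> x) = h x"
    using tensor_lift_hom[OF assms(1,2)] by metis
  then show ?thesis
    using assms(3,4) by (simp add: tens_def)
qed

lemma tensor_lift_additive:
  assumes "abelian_group P" "balanced A M N P f"
  shows "additive_map T P (tensor_lift P f)"
proof -
  obtain h where h: "h \<in> hom FA (add_monoid P)"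
    and eq: "\<And>x. x \<in> carrier FA \<Longrightarrow> tensor_lift P f (K #>\<^bsub>FA\<^esub> x) = h x"
    using tensor_lift_hom[OF assms] by metis
  show ?thesis
  proof (rule additive_mapI)
    show "tensor_lift P f x \<in> carrier P" if "x \<in> carrier T" for x
    proof -
      obtain x' where x': "x' \<in> carrier FA" "x = K #>\<^bsub>FA\<^esub> x'"
        using \<open>x \<in> carrier T\<close> by (rule T_cosetE)
      then show ?thesis
        using hom_in_carrier[OF h x'(1)] eq[OF x'(1)] by simp
    qed
    show "tensor_lift P f (x \<oplus>\<^bsub>T\<^esub> y) = tensor_lift P f x \<oplus>\<^bsub>P\<^esub> tensor_lift P f y"
      if "x \<in> carrier T" "y \<in> carrier T" for x y
    proof -
      obtain x' where x': "x' \<in> carrier FA" "x = K #>\<^bsub>FA\<^esub> x'"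
        using \<open>x \<in> carrier T\<close> by (rule T_cosetE)
      obtain y' where y': "y' \<in> carrier FA" "y = K #>\<^bsub>FA\<^esub> y'"
        using \<open>y \<in> carrier T\<close> by (rule T_cosetE)
      have "x' + y' \<in> carrier FA"
        using FA.m_closed[OF x'(1) y'(1)] by (simp only: mult_free_Abelian_group)
      moreover have "h (x' + y') = h x' \<oplus>\<^bsub>P\<^esub> h y'"
        using hom_mult[OF h x'(1) y'(1)] by (simp only: mult_free_Abelian_group monoid.select_convs)
      ultimately show ?thesis
        using eq x'(1) y'(1) by (simp only: x'(2) y'(2) coset_add)
    qed
  qed
qed

text \<open>
  Pure tensors generate \<open>M \<otimes>\<^sub>A N\<close> as an abelian group. Every identity between maps on a tensor
  product below is checked on pure tensors through this rule.
\<close>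
lemma tensor_additive_eqI:
  assumes P: "abelian_group P" and F: "additive_map T P F" and G: "additive_map T P G"
    and eq: "\<And>m n. \<lbrakk>m \<in> carrier M; n \<in> carrier N\<rbrakk> \<Longrightarrow> F (t m n) = G (t m n)"
    and z: "z \<in> carrier T"
  shows "F z = G z"
proof -
  interpret P: abelian_group P by fact
  obtain x where x: "x \<in> carrier FA" "z = K #>\<^bsub>FA\<^esub> x"
    using z by (rule T_cosetE)
  have "Poly_Mapping.keys x \<subseteq> carrier M \<times> carrier N"
    using x by simp
  then have "F (K #>\<^bsub>FA\<^esub> x) = G (K #>\<^bsub>FA\<^esub> x)"
  proof (induction x rule: free_Abelian_group_induct[consumes 1, case_names zero diff gen])
    case zero
    interpret K: normal K FA by (rule kernel_normal)
    have "K #>\<^bsub>FA\<^esub> 0 = \<zero>\<^bsub>T\<^esub>"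
      using FA.coset_mult_one[OF K.subset] by (simp add: zero_T tensor_group_def FactGroup_def)
    then show ?case
      by (simp add: additive_map_zero[OF abelian_group_T P F] additive_map_zero[OF abelian_group_T P G])
  next
    case (diff x y)
    then have cl: "x \<in> carrier FA" "y \<in> carrier FA" "- y \<in> carrier FA"
      by simp_all
    interpret c: group_hom FA "add_monoid T" "\<lambda>x. K #>\<^bsub>FA\<^esub> x"
      by (simp add: group_hom_def group_hom_axioms_def FA.is_group T.a_group coset_hom)
    have "K #>\<^bsub>FA\<^esub> (x - y) = (K #>\<^bsub>FA\<^esub> x) \<oplus>\<^bsub>T\<^esub> (\<ominus>\<^bsub>T\<^esub> (K #>\<^bsub>FA\<^esub> y))"
      using coset_add[OF cl(1,3)] c.hom_inv[OF cl(2)] diff(1,2) by (simp add: a_inv_def)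
    then show ?case
      using diff(3,4) coset_in_T[OF cl(1)] coset_in_T[OF cl(2)]
      by (simp only: additive_mapD(2)[OF F] additive_mapD(2)[OF G] T.a_inv_closed
          additive_map_minus[OF abelian_group_T P F] additive_map_minus[OF abelian_group_T P G])
  next
    case (gen a)
    then show ?case
      using eq by (cases a) (auto simp: tens_def)
  qed
  then show ?thesis
    using x by simp
qed

lemma smult_T: "r \<odot>\<^bsub>T\<^esub> z = tensor_lift T (\<lambda>m n. t (r \<odot>\<^bsub>M\<^esub> m) n) z"
  and rsmult_T: "z \<bullet>\<^bsub>T\<^esub> s = tensor_lift T (\<lambda>m n. t m (n \<bullet>\<^bsub>N\<^esub> s)) z"
proof -
  have eq: "tensor_lift T f = tensor_lift (tensor_additive A M N) f" for f
    by (rule tensor_lift_cong_additive) (simp_all add: tensor_additive_def tensor_def)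
  show "r \<odot>\<^bsub>T\<^esub> z = tensor_lift T (\<lambda>m n. t (r \<odot>\<^bsub>M\<^esub> m) n) z"
    "z \<bullet>\<^bsub>T\<^esub> s = tensor_lift T (\<lambda>m n. t m (n \<bullet>\<^bsub>N\<^esub> s)) z"
    unfolding eq by (simp_all add: tensor_def)
qed

lemma balanced_smult:
  assumes "r \<in> carrier R"
  shows "balanced A M N T (\<lambda>m n. t (r \<odot>\<^bsub>M\<^esub> m) n)"
  by (rule balancedI)
    (use assms in \<open>simp_all add: tens_add_left tens_add_right left.lsmult_closed left.lsmult_add
       tens_balance[symmetric] left.lsmult_rsmult\<close>)

lemma balanced_rsmult:
  assumes "s \<in> carrier S"
  shows "balanced A M N T (\<lambda>m n. t m (n \<bullet>\<^bsub>N\<^esub> s))"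
  by (rule balancedI)
    (use assms in \<open>simp_all add: tens_add_left tens_add_right right.rsmult_closed right.rsmult_add
       tens_balance right.lsmult_rsmult\<close>)

lemma additive_smult: "r \<in> carrier R \<Longrightarrow> additive_map T T (\<lambda>z. r \<odot>\<^bsub>T\<^esub> z)"
  unfolding smult_T by (rule tensor_lift_additive[OF abelian_group_T balanced_smult])

lemma additive_rsmult: "s \<in> carrier S \<Longrightarrow> additive_map T T (\<lambda>z. z \<bullet>\<^bsub>T\<^esub> s)"
  unfolding rsmult_T by (rule tensor_lift_additive[OF abelian_group_T balanced_rsmult])

lemma smult_tens [simp]:
  "\<lbrakk>r \<in> carrier R; m \<in> carrier M; n \<in> carrier N\<rbrakk> \<Longrightarrow> r \<odot>\<^bsub>T\<^esub> t m n = t (r \<odot>\<^bsub>M\<^esub> m) n"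
  unfolding smult_T by (rule tensor_lift_tens[OF abelian_group_T balanced_smult])

lemma rsmult_tens [simp]:
  "\<lbrakk>s \<in> carrier S; m \<in> carrier M; n \<in> carrier N\<rbrakk> \<Longrightarrow> t m n \<bullet>\<^bsub>T\<^esub> s = t m (n \<bullet>\<^bsub>N\<^esub> s)"
  unfolding rsmult_T by (rule tensor_lift_tens[OF abelian_group_T balanced_rsmult])

lemma bimodule_T: "bimodule R S T"
proof -
  note eqI = tensor_additive_eqI[OF abelian_group_T]
  note add = additive_map_add[OF abelian_group_T]
  note closed = left.lsmult_closed right.rsmult_closed
  have h1: "(a \<oplus>\<^bsub>R\<^esub> b) \<odot>\<^bsub>T\<^esub> x = a \<odot>\<^bsub>T\<^esub> x \<oplus>\<^bsub>T\<^esub> b \<odot>\<^bsub>T\<^esub> x"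
    if "a \<in> carrier R" "b \<in> carrier R" "x \<in> carrier T" for a b x
    by (rule eqI[OF additive_smult add[OF additive_smult additive_smult]])
      (use that in \<open>simp_all add: closed tens_add_left left.lsmult_add_scalar\<close>)
  have h2: "(a \<otimes>\<^bsub>R\<^esub> b) \<odot>\<^bsub>T\<^esub> x = a \<odot>\<^bsub>T\<^esub> (b \<odot>\<^bsub>T\<^esub> x)"
    if "a \<in> carrier R" "b \<in> carrier R" "x \<in> carrier T" for a b x
    by (rule eqI[OF additive_smult additive_map_compose[OF additive_smult additive_smult]])
      (use that in \<open>simp_all add: closed left.lsmult_assoc\<close>)
  have h3: "\<one>\<^bsub>R\<^esub> \<odot>\<^bsub>T\<^esub> x = x" if "x \<in> carrier T" for x
    by (rule eqI[OF additive_smult additive_map_id]) (use that in \<open>simp_all add: left.lsmult_one\<close>)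
  have h4: "x \<bullet>\<^bsub>T\<^esub> (a \<oplus>\<^bsub>S\<^esub> b) = x \<bullet>\<^bsub>T\<^esub> a \<oplus>\<^bsub>T\<^esub> x \<bullet>\<^bsub>T\<^esub> b"
    if "a \<in> carrier S" "b \<in> carrier S" "x \<in> carrier T" for a b x
    by (rule eqI[OF additive_rsmult add[OF additive_rsmult additive_rsmult]])
      (use that in \<open>simp_all add: closed tens_add_right right.rsmult_add_scalar\<close>)
  have h5: "x \<bullet>\<^bsub>T\<^esub> (a \<otimes>\<^bsub>S\<^esub> b) = (x \<bullet>\<^bsub>T\<^esub> a) \<bullet>\<^bsub>T\<^esub> b"
    if "a \<in> carrier S" "b \<in> carrier S" "x \<in> carrier T" for a b x
    by (rule eqI[OF additive_rsmult additive_map_compose[OF additive_rsmult additive_rsmult]])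
      (use that in \<open>simp_all add: closed right.rsmult_assoc\<close>)
  have h6: "x \<bullet>\<^bsub>T\<^esub> \<one>\<^bsub>S\<^esub> = x" if "x \<in> carrier T" for x
    by (rule eqI[OF additive_rsmult additive_map_id]) (use that in \<open>simp_all add: right.rsmult_one\<close>)
  have h7: "(a \<odot>\<^bsub>T\<^esub> x) \<bullet>\<^bsub>T\<^esub> s = a \<odot>\<^bsub>T\<^esub> (x \<bullet>\<^bsub>T\<^esub> s)"
    if "a \<in> carrier R" "x \<in> carrier T" "s \<in> carrier S" for a x s
    by (rule eqI[OF additive_map_compose[OF additive_smult additive_rsmult]
          additive_map_compose[OF additive_rsmult additive_smult]])
      (use that in \<open>simp_all add: closed\<close>)
  show ?thesis
    by unfold_locales
      (rule h1 h2 h3 h4 h5 h6 h7 additive_mapD[OF additive_smult] additive_mapD[OF additive_rsmult];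
       assumption)+
qed

end

section \<open>Bimodules from rings, and the associator\<close>

lemma ring_bimodule_simps [simp]:
  "carrier (ring_bimodule f g R) = carrier R"
  "add (ring_bimodule f g R) = add R"
  "\<zero>\<^bsub>ring_bimodule f g R\<^esub> = \<zero>\<^bsub>R\<^esub>"
  "a \<odot>\<^bsub>ring_bimodule f g R\<^esub> x = f a \<otimes>\<^bsub>R\<^esub> x"
  "x \<bullet>\<^bsub>ring_bimodule f g R\<^esub> b = x \<otimes>\<^bsub>R\<^esub> g b"
  by (simp_all add: ring_bimodule_def)

lemma bimodule_ring_bimodule:
  assumes "ring S" "ring T" "ring R" "f \<in> ring_hom S R" "g \<in> ring_hom T R"
  shows "bimodule S T (ring_bimodule f g R)"
proof -
  interpret S: ring S by fact
  interpret T: ring T by fact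
  interpret R: ring R by fact
  have ag: "abelian_group (ring_bimodule f g R)"
    by (rule abelian_groupI) (auto simp: R.add.m_ac intro: R.add.l_inv_ex)
  show ?thesis
    unfolding bimodule_def left_module_def left_module_axioms_def bimodule_axioms_def
    using ag assms(1,2) ring_hom_closed[OF assms(4)] ring_hom_closed[OF assms(5)]
    by (auto simp: ring_hom_add[OF assms(4)] ring_hom_add[OF assms(5)] ring_hom_mult[OF assms(4)]
        ring_hom_mult[OF assms(5)] ring_hom_one[OF assms(4)] ring_hom_one[OF assms(5)]
        R.l_distr R.r_distr R.m_assoc)
qed

text \<open>
  The value of the associator is recorded on \<open>u \<otimes> p\<close> for arbitrary \<open>u\<close>, because coassociativity applies it with
  \<open>u = \<Delta>(x)\<close>, which is no pure tensor in general.
\<close>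
lemma
  fixes A :: "('a, 'e) ring_scheme" and B :: "('b, 'f) ring_scheme"
  assumes M: "bimodule R A M" and N: "bimodule A B N" and P: "bimodule B S P"
  shows tensor_assoc_additive: "additive_map (tensor B (tensor A M N) P) (tensor A M (tensor B N P))
            (tensor_assoc A B M N P)" (is ?add)
    and tensor_assoc_tens: "\<lbrakk>u \<in> carrier (tensor A M N); p \<in> carrier P\<rbrakk> \<Longrightarrow>
      tensor_assoc A B M N P (tens B (tensor A M N) P u p) =
      tensor_lift (tensor A M (tensor B N P)) (\<lambda>m n. tens A M (tensor B N P) m (tens B N P n p)) u"
      (is "_ \<Longrightarrow> _ \<Longrightarrow> ?eq u p")
    and balanced_tens_tens: "p \<in> carrier P \<Longrightarrow> balanced A M N (tensor A M (tensor B N P))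
      (\<lambda>m n. tens A M (tensor B N P) m (tens B N P n p))"
proof -
  interpret MN: tensor_product R A B M N by (rule tensor_product.intro[OF M N])
  interpret NP: tensor_product A B S N P by (rule tensor_product.intro[OF N P])
  interpret MN_P: tensor_product R B S MN.T P by (rule tensor_product.intro[OF MN.bimodule_T P])
  interpret M_NP: tensor_product R A S M NP.T by (rule tensor_product.intro[OF M NP.bimodule_T])
  let ?T = M_NP.T
  let ?l = "\<lambda>u p. tensor_lift ?T (\<lambda>m n. M_NP.t m (NP.t n p)) u"
  have bal: "balanced A M N ?T (\<lambda>m n. M_NP.t m (NP.t n p))" if "p \<in> carrier P" for p
  proof (rule balancedI)
    show "M_NP.t (m \<bullet>\<^bsub>M\<^esub> a) (NP.t n p) = M_NP.t m (NP.t (a \<odot>\<^bsub>N\<^esub> n) p)"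
      if "m \<in> carrier M" "a \<in> carrier A" "n \<in> carrier N" for m a n
      using that \<open>p \<in> carrier P\<close>
      by (simp add: M_NP.tens_balance NP.smult_tens)
  qed (use that in \<open>simp_all add: NP.tens_closed M_NP.tens_closed NP.tens_add_left M_NP.tens_add_left
        M_NP.tens_add_right\<close>)
  then show "balanced A M N ?T (\<lambda>m n. M_NP.t m (NP.t n p))" if "p \<in> carrier P" for p
    using that .
  have add: "additive_map MN.T ?T (\<lambda>u. ?l u p)" if "p \<in> carrier P" for p
    by (rule MN.tensor_lift_additive[OF M_NP.abelian_group_T bal[OF that]])
  have lt: "?l (MN.t m n) p = M_NP.t m (NP.t n p)"
    if "p \<in> carrier P" "m \<in> carrier M" "n \<in> carrier N" for m n p
    by (rule MN.tensor_lift_tens[OF M_NP.abelian_group_T bal]) (use that in auto)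
  note eqI = MN.tensor_additive_eqI[OF M_NP.abelian_group_T]
  have bal2: "balanced B MN.T P ?T ?l"
  proof (rule balancedI)
    show "?l u p \<in> carrier ?T" if "u \<in> carrier MN.T" "p \<in> carrier P" for u p
      using that by (auto intro: additive_mapD(1)[OF add])
    show "?l (u \<oplus>\<^bsub>MN.T\<^esub> u') p = ?l u p \<oplus>\<^bsub>?T\<^esub> ?l u' p"
      if "u \<in> carrier MN.T" "u' \<in> carrier MN.T" "p \<in> carrier P" for u u' p
      using that by (simp add: additive_mapD(2)[OF add])
    show "?l u (p \<oplus>\<^bsub>P\<^esub> p') = ?l u p \<oplus>\<^bsub>?T\<^esub> ?l u p'"
      if "u \<in> carrier MN.T" "p \<in> carrier P" "p' \<in> carrier P" for u p p'
      by (rule eqI[OF add additive_map_add[OF M_NP.abelian_group_T add add]])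
        (use that in \<open>simp_all add: lt NP.tens_add_right M_NP.tens_add_right NP.tens_closed\<close>)
    show "?l (u \<bullet>\<^bsub>MN.T\<^esub> b) p = ?l u (b \<odot>\<^bsub>P\<^esub> p)"
      if "u \<in> carrier MN.T" "b \<in> carrier B" "p \<in> carrier P" for u b p
      by (rule eqI[OF additive_map_compose[OF MN.additive_rsmult add] add])
        (use that in \<open>simp_all add: lt NP.tens_balance NP.right.lsmult_closed MN.right.rsmult_closed\<close>)
  qed
  have assoc: "tensor_assoc A B M N P = tensor_lift ?T ?l"
    by (simp add: tensor_assoc_def Let_def fun_eq_iff)
  show ?add
    unfolding assoc by (rule MN_P.tensor_lift_additive[OF M_NP.abelian_group_T bal2])
  show "?eq u p" if "u \<in> carrier MN.T" "p \<in> carrier P" for u p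
    unfolding assoc by (rule MN_P.tensor_lift_tens[OF M_NP.abelian_group_T bal2 that])
qed

lemma (in bimodule) additive_lsmult: "a \<in> carrier R \<Longrightarrow> additive_map M M (\<lambda>x. a \<odot>\<^bsub>M\<^esub> x)"
  by (rule additive_mapI) (simp_all add: lsmult_closed lsmult_add)

lemma (in bimodule) additive_rsmult: "s \<in> carrier S \<Longrightarrow> additive_map M M (\<lambda>x. x \<bullet>\<^bsub>M\<^esub> s)"
  by (rule additive_mapI) (simp_all add: rsmult_closed rsmult_add)

section \<open>The left dual ring of a coring\<close>

context coring
begin

abbreviation "LD \<equiv> left_dual A C"

definition contract :: "('c \<Rightarrow> 'a) \<Rightarrow> ('c \<times> 'c \<Rightarrow>\<^sub>0 int) set \<Rightarrow> 'c" where
  "contract \<phi> = tensor_lift C (\<lambda>x y. x \<bullet>\<^bsub>C\<^esub> \<phi> y)"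

text \<open>
  In Sweedler notation \<open>translate \<phi> c\<close> is \<open>c\<^sub>(\<^sub>1\<^sub>) \<phi>(c\<^sub>(\<^sub>2\<^sub>))\<close>. The product of the left dual is
  \<open>\<phi> * \<psi> = \<psi> \<circ> translate \<phi>\<close>, so the ring axioms are statements about the maps \<open>translate \<phi>\<close>.
\<close>
definition translate :: "('c \<Rightarrow> 'a) \<Rightarrow> 'c \<Rightarrow> 'c" where
  "translate \<phi> c = contract \<phi> (comult C c)"

lemma ring_A: "ring A" and abelian_C: "abelian_group C" and abelian_A: "abelian_group A"
  and bimodule_C: "bimodule A A C"
  by unfold_locales

sublocale CC: tensor_product A A A C C
  by (rule tensor_product.intro[OF bimodule_C bimodule_C])

lemma left_dual_simps:
  "\<zero>\<^bsub>LD\<^esub> = (\<lambda>c\<in>carrier C. \<zero>\<^bsub>A\<^esub>)"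
  "\<phi> \<oplus>\<^bsub>LD\<^esub> \<psi> = (\<lambda>c\<in>carrier C. \<phi> c \<oplus>\<^bsub>A\<^esub> \<psi> c)"
  "\<one>\<^bsub>LD\<^esub> = restrict (counit C) (carrier C)"
  "\<phi> \<otimes>\<^bsub>LD\<^esub> \<psi> = (\<lambda>c\<in>carrier C. \<psi> (translate \<phi> c))"
  by (simp_all add: left_dual_def contract_def translate_def)

lemma left_dual_apply:
  assumes "c \<in> carrier C"
  shows "(\<phi> \<oplus>\<^bsub>LD\<^esub> \<psi>) c = \<phi> c \<oplus>\<^bsub>A\<^esub> \<psi> c"
    and "(\<phi> \<otimes>\<^bsub>LD\<^esub> \<psi>) c = \<psi> (translate \<phi> c)"
  using assms by (simp_all add: left_dual_simps)

lemma additive_regular: "additive_map M (regular_bimodule A) f \<longleftrightarrow> additive_map M A f"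
  by (simp add: additive_map_def)

lemma left_dual_carrier: "\<phi> \<in> carrier LD \<longleftrightarrow> \<phi> \<in> extensional (carrier C) \<and>
    additive_map C A \<phi> \<and> (\<forall>a\<in>carrier A. \<forall>x\<in>carrier C. \<phi> (a \<odot>\<^bsub>C\<^esub> x) = a \<otimes>\<^bsub>A\<^esub> \<phi> x)"
  by (simp add: left_dual_def left_Hom_def left_linear_def additive_regular)

lemma left_dualD:
  assumes "\<phi> \<in> carrier LD"
  shows "\<phi> \<in> extensional (carrier C)" "additive_map C A \<phi>"
    and "x \<in> carrier C \<Longrightarrow> \<phi> x \<in> carrier A"
    and "\<lbrakk>x \<in> carrier C; y \<in> carrier C\<rbrakk> \<Longrightarrow> \<phi> (x \<oplus>\<^bsub>C\<^esub> y) = \<phi> x \<oplus>\<^bsub>A\<^esub> \<phi> y"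
    and "\<lbrakk>a \<in> carrier A; x \<in> carrier C\<rbrakk> \<Longrightarrow> \<phi> (a \<odot>\<^bsub>C\<^esub> x) = a \<otimes>\<^bsub>A\<^esub> \<phi> x"
  using assms by (auto simp: left_dual_carrier additive_map_def)

lemma left_dual_eqI:
  assumes "\<phi> \<in> carrier LD" "\<psi> \<in> carrier LD" "\<And>c. c \<in> carrier C \<Longrightarrow> \<phi> c = \<psi> c"
  shows "\<phi> = \<psi>"
  using assms left_dualD(1) by (metis extensionalityI)

lemma left_dual_restrictI:
  assumes "additive_map C A f" "\<And>a x. \<lbrakk>a \<in> carrier A; x \<in> carrier C\<rbrakk> \<Longrightarrow> f (a \<odot>\<^bsub>C\<^esub> x) = a \<otimes>\<^bsub>A\<^esub> f x"
  shows "restrict f (carrier C) \<in> carrier LD"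
  using assms unfolding left_dual_carrier additive_map_def by (auto simp: lsmult_closed)

lemma counit_additive: "additive_map C A (counit C)"
  and counit_lsmult: "\<lbrakk>a \<in> carrier A; x \<in> carrier C\<rbrakk> \<Longrightarrow> counit C (a \<odot>\<^bsub>C\<^esub> x) = a \<otimes>\<^bsub>A\<^esub> counit C x"
  and counit_rsmult: "\<lbrakk>a \<in> carrier A; x \<in> carrier C\<rbrakk> \<Longrightarrow> counit C (x \<bullet>\<^bsub>C\<^esub> a) = counit C x \<otimes>\<^bsub>A\<^esub> a"
  using counit_left_linear counit_right_linear
  by (simp_all add: left_linear_def right_linear_def additive_regular)

lemma counit_closed: "x \<in> carrier C \<Longrightarrow> counit C x \<in> carrier A"
  by (rule additive_mapD(1)[OF counit_additive])

lemma comult_additive: "additive_map C CC.T (comult C)"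
  and comult_lsmult: "\<lbrakk>a \<in> carrier A; x \<in> carrier C\<rbrakk> \<Longrightarrow> comult C (a \<odot>\<^bsub>C\<^esub> x) = a \<odot>\<^bsub>CC.T\<^esub> comult C x"
  and comult_rsmult: "\<lbrakk>a \<in> carrier A; x \<in> carrier C\<rbrakk> \<Longrightarrow> comult C (x \<bullet>\<^bsub>C\<^esub> a) = comult C x \<bullet>\<^bsub>CC.T\<^esub> a"
  using comult_left_linear comult_right_linear
  by (simp_all add: left_linear_def right_linear_def)

lemma comult_closed: "x \<in> carrier C \<Longrightarrow> comult C x \<in> carrier CC.T"
  by (rule additive_mapD(1)[OF comult_additive])

lemmas CC_eqI = CC.tensor_additive_eqI[OF abelian_C]

lemma balanced_contract:
  assumes "\<phi> \<in> carrier LD"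
  shows "balanced A C C C (\<lambda>x y. x \<bullet>\<^bsub>C\<^esub> \<phi> y)"
  by (rule balancedI) (simp_all add: left_dualD(3-5)[OF assms] rsmult_closed rsmult_add
      rsmult_add_scalar rsmult_assoc)

lemma contract_additive: "\<phi> \<in> carrier LD \<Longrightarrow> additive_map CC.T C (contract \<phi>)"
  unfolding contract_def by (rule CC.tensor_lift_additive[OF abelian_C balanced_contract])

lemma contract_tens:
  "\<lbrakk>\<phi> \<in> carrier LD; x \<in> carrier C; y \<in> carrier C\<rbrakk> \<Longrightarrow> contract \<phi> (CC.t x y) = x \<bullet>\<^bsub>C\<^esub> \<phi> y"
  unfolding contract_def by (rule CC.tensor_lift_tens[OF abelian_C balanced_contract])

lemma contract_lsmult:
  assumes \<phi>: "\<phi> \<in> carrier LD" and a: "a \<in> carrier A" and z: "z \<in> carrier CC.T"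
  shows "contract \<phi> (a \<odot>\<^bsub>CC.T\<^esub> z) = a \<odot>\<^bsub>C\<^esub> contract \<phi> z"
  by (rule CC_eqI[OF additive_map_compose[OF CC.additive_smult[OF a] contract_additive[OF \<phi>]]
        additive_map_compose[OF contract_additive[OF \<phi>] additive_lsmult[OF a]]])
    (use a z in \<open>simp_all add: contract_tens \<phi> lsmult_closed left_dualD(3)[OF \<phi>] lsmult_rsmult\<close>)

lemma translate_additive: "\<phi> \<in> carrier LD \<Longrightarrow> additive_map C C (translate \<phi>)"
  unfolding translate_def[abs_def]
  by (rule additive_map_compose[OF comult_additive contract_additive])

lemma translate_closed: "\<lbrakk>\<phi> \<in> carrier LD; c \<in> carrier C\<rbrakk> \<Longrightarrow> translate \<phi> c \<in> carrier C"
  using additive_mapD(1)[OF translate_additive] .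

lemma translate_lsmult:
  "\<lbrakk>\<phi> \<in> carrier LD; a \<in> carrier A; c \<in> carrier C\<rbrakk> \<Longrightarrow>
    translate \<phi> (a \<odot>\<^bsub>C\<^esub> c) = a \<odot>\<^bsub>C\<^esub> translate \<phi> c"
  by (simp add: translate_def comult_lsmult contract_lsmult comult_closed)

lemma left_dual_mult_closed:
  assumes "\<phi> \<in> carrier LD" "\<psi> \<in> carrier LD"
  shows "\<phi> \<otimes>\<^bsub>LD\<^esub> \<psi> \<in> carrier LD"
  unfolding left_dual_simps
  by (rule left_dual_restrictI[OF additive_map_compose[OF translate_additive left_dualD(2)]])
    (simp_all add: assms translate_lsmult translate_closed left_dualD(5)[OF assms(2)])

lemma left_dual_add_closed:
  assumes "\<phi> \<in> carrier LD" "\<psi> \<in> carrier LD"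
  shows "\<phi> \<oplus>\<^bsub>LD\<^esub> \<psi> \<in> carrier LD"
  unfolding left_dual_simps
  by (rule left_dual_restrictI[OF additive_map_add[OF abelian_A left_dualD(2) left_dualD(2)]])
    (simp_all add: assms left_dualD[OF assms(1)] left_dualD[OF assms(2)] R.r_distr)

lemma left_dual_one_closed: "\<one>\<^bsub>LD\<^esub> \<in> carrier LD"
  unfolding left_dual_simps
  by (rule left_dual_restrictI[OF counit_additive]) (rule counit_lsmult)

text \<open>
  This is where coassociativity enters; it makes the left dual associative. Let \<open>\<theta>\<close> send
  \<open>x \<otimes> (y \<otimes> z)\<close> to \<open>x \<psi>(y \<phi>(z))\<close>. Applying \<open>\<theta>\<close> to \<open>(id \<otimes> \<Delta>)(\<Delta> c)\<close> gives the left-hand side.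
  Applying it to \<open>(\<Delta> \<otimes> id)(\<Delta> c)\<close>, reassociated, gives the right-hand side, because \<open>\<Delta>\<close> is right linear.
\<close>
lemma translate_mult:
  assumes \<phi>: "\<phi> \<in> carrier LD" and \<psi>: "\<psi> \<in> carrier LD" and c: "c \<in> carrier C"
  shows "translate (\<phi> \<otimes>\<^bsub>LD\<^esub> \<psi>) c = translate \<psi> (translate \<phi> c)"
proof -
  interpret C_CC: tensor_product A A A C CC.T by (rule tensor_product.intro[OF bimodule_C CC.bimodule_T])
  interpret CC_C: tensor_product A A A CC.T C by (rule tensor_product.intro[OF CC.bimodule_T bimodule_C])
  note assoc = tensor_assoc_tens[OF bimodule_C bimodule_C bimodule_C]
  note assoc_add = tensor_assoc_additive[OF bimodule_C bimodule_C bimodule_C]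
  note \<phi>\<psi> = left_dual_mult_closed[OF \<phi> \<psi>]
  have con: "contract \<phi> w \<in> carrier C" if "w \<in> carrier CC.T" for w
    using additive_mapD(1)[OF contract_additive[OF \<phi>] that] .
  define \<theta> where "\<theta> = tensor_lift C (\<lambda>x w. x \<bullet>\<^bsub>C\<^esub> \<psi> (contract \<phi> w))"
  have bal: "balanced A C CC.T C (\<lambda>x w. x \<bullet>\<^bsub>C\<^esub> \<psi> (contract \<phi> w))"
    by (rule balancedI)
      (simp_all add: con left_dualD(3-5)[OF \<psi>] contract_lsmult \<phi> rsmult_closed rsmult_add
        rsmult_add_scalar rsmult_assoc additive_mapD(2)[OF contract_additive[OF \<phi>]])
  have \<theta>_add: "additive_map C_CC.T C \<theta>"
    unfolding \<theta>_def by (rule C_CC.tensor_lift_additive[OF abelian_C bal])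
  have \<theta>_tens: "\<theta> (C_CC.t x w) = x \<bullet>\<^bsub>C\<^esub> \<psi> (contract \<phi> w)"
    if "x \<in> carrier C" "w \<in> carrier CC.T" for x w
    unfolding \<theta>_def by (rule C_CC.tensor_lift_tens[OF abelian_C bal that])
  have bal_l: "balanced A C C C_CC.T (\<lambda>m n. C_CC.t m (comult C n))"
    by (rule balancedI) (simp_all add: comult_closed additive_mapD(2)[OF comult_additive]
        C_CC.tens_add_left C_CC.tens_add_right C_CC.tens_balance comult_lsmult)
  have id_comult: "\<theta> (tensor_map A C CC.T (\<lambda>d. d) (comult C) w) = contract (\<phi> \<otimes>\<^bsub>LD\<^esub> \<psi>) w"
    if "w \<in> carrier CC.T" for w
    unfolding tensor_map_def
    by (rule CC_eqI[OF additive_map_compose[OF CC.tensor_lift_additive[OF C_CC.abelian_group_T bal_l] \<theta>_add]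
          contract_additive[OF \<phi>\<psi>] _ that])
      (simp add: CC.tensor_lift_tens[OF C_CC.abelian_group_T bal_l] \<theta>_tens comult_closed
        contract_tens[OF \<phi>\<psi>], simp add: left_dual_simps translate_def)
  have bal_r: "balanced A C C CC_C.T (\<lambda>m n. CC_C.t (comult C m) n)"
    by (rule balancedI) (simp_all add: comult_closed additive_mapD(2)[OF comult_additive]
        CC_C.tens_add_left CC_C.tens_add_right CC_C.tens_balance comult_rsmult)
  have inner: "\<theta> (tensor_lift C_CC.T (\<lambda>m n. C_CC.t m (CC.t n z)) u) = contract \<psi> (u \<bullet>\<^bsub>CC.T\<^esub> \<phi> z)"
    if z: "z \<in> carrier C" and u: "u \<in> carrier CC.T" for z u
  proof -
    note bt = balanced_tens_tens[OF bimodule_C bimodule_C bimodule_C z]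
    have \<phi>z: "\<phi> z \<in> carrier A"
      using left_dualD(3)[OF \<phi> z] .
    show ?thesis
      by (rule CC_eqI[OF additive_map_compose[OF CC.tensor_lift_additive[OF C_CC.abelian_group_T bt] \<theta>_add]
            additive_map_compose[OF CC.additive_rsmult[OF \<phi>z] contract_additive[OF \<psi>]] _ u])
        (use z \<phi>z in \<open>simp add: CC.tensor_lift_tens[OF C_CC.abelian_group_T bt] \<theta>_tens
          contract_tens[OF \<phi>] contract_tens[OF \<psi>] rsmult_closed\<close>)
  qed
  have comult_id: "\<theta> (tensor_assoc A A C C C (tensor_map A CC.T C (comult C) (\<lambda>d. d) w)) =
      translate \<psi> (contract \<phi> w)" if "w \<in> carrier CC.T" for w
    unfolding tensor_map_def
    by (rule CC_eqI[OF additive_map_compose[OF CC.tensor_lift_additive[OF CC_C.abelian_group_T bal_r]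
            additive_map_compose[OF assoc_add \<theta>_add]]
          additive_map_compose[OF contract_additive[OF \<phi>] translate_additive[OF \<psi>]] _ that])
      (simp add: CC.tensor_lift_tens[OF CC_C.abelian_group_T bal_r] assoc comult_closed inner
        contract_tens[OF \<phi>] translate_def comult_rsmult left_dualD(3)[OF \<phi>])
  show ?thesis
    using id_comult[OF comult_closed[OF c]] comult_id[OF comult_closed[OF c]] coassociative[OF c]
    by (simp add: translate_def)
qed

lemma translate_add:
  assumes \<phi>: "\<phi> \<in> carrier LD" and \<psi>: "\<psi> \<in> carrier LD" and c: "c \<in> carrier C"
  shows "translate (\<phi> \<oplus>\<^bsub>LD\<^esub> \<psi>) c = translate \<phi> c \<oplus>\<^bsub>C\<^esub> translate \<psi> c"
  unfolding translate_def
  by (rule CC_eqI[OF contract_additive additive_map_add[OF abelian_C contract_additive contract_additive]])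
    (simp_all add: contract_tens left_dual_add_closed \<phi> \<psi> comult_closed c left_dual_apply
      rsmult_add_scalar left_dualD(3)[OF \<phi>] left_dualD(3)[OF \<psi>])

text \<open>
  By the counit law \<open>c\<^sub>(\<^sub>1\<^sub>) \<epsilon>(c\<^sub>(\<^sub>2\<^sub>)) = c\<close>. For \<open>a = 1\<close> it says that the counit is a left unit of the left dual.
\<close>
lemma translate_left_dual_map:
  assumes a: "a \<in> carrier A" and ia: "left_dual_map A C a \<in> carrier LD" and c: "c \<in> carrier C"
  shows "translate (left_dual_map A C a) c = c \<bullet>\<^bsub>C\<^esub> a"
proof -
  have bal: "balanced A C C C (\<lambda>x y. x \<bullet>\<^bsub>C\<^esub> counit C y)"
    by (rule balancedI) (simp_all add: counit_closed counit_lsmult additive_mapD(2)[OF counit_additive]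
        rsmult_closed rsmult_add rsmult_add_scalar rsmult_assoc)
  have "contract (left_dual_map A C a) w = tensor_lift C (\<lambda>x y. x \<bullet>\<^bsub>C\<^esub> counit C y) w \<bullet>\<^bsub>C\<^esub> a"
    if "w \<in> carrier CC.T" for w
    by (rule CC_eqI[OF contract_additive[OF ia]
          additive_map_compose[OF CC.tensor_lift_additive[OF abelian_C bal] additive_rsmult[OF a]] _ that])
      (simp add: contract_tens ia CC.tensor_lift_tens[OF abelian_C bal], simp add: left_dual_map_def
        counit_closed rsmult_assoc a)
  then show ?thesis
    using counit_right[OF c] comult_closed[OF c] by (simp add: translate_def)
qed

lemma left_dual_map_one: "left_dual_map A C \<one>\<^bsub>A\<^esub> = \<one>\<^bsub>LD\<^esub>"
  by (auto simp: left_dual_map_def left_dual_simps counit_closed)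

lemma left_dual_map_closed:
  assumes "a \<in> carrier A"
  shows "left_dual_map A C a \<in> carrier LD"
  unfolding left_dual_map_def
  by (rule left_dual_restrictI[OF additive_mapI])
    (use assms in \<open>simp_all add: counit_closed counit_lsmult additive_mapD(2)[OF counit_additive]
      R.l_distr R.m_assoc\<close>)

lemma translate_one: "c \<in> carrier C \<Longrightarrow> translate \<one>\<^bsub>LD\<^esub> c = c"
  using translate_left_dual_map[of "\<one>\<^bsub>A\<^esub>"] left_dual_map_closed[of "\<one>\<^bsub>A\<^esub>"]
  by (simp add: left_dual_map_one rsmult_one)

text \<open>
  The counit is a right unit: \<open>\<epsilon>(c\<^sub>(\<^sub>1\<^sub>) \<phi>(c\<^sub>(\<^sub>2\<^sub>))) = \<phi>(\<epsilon>(c\<^sub>(\<^sub>1\<^sub>)) c\<^sub>(\<^sub>2\<^sub>)) = \<phi>(c)\<close>.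
\<close>
lemma counit_translate:
  assumes \<phi>: "\<phi> \<in> carrier LD" and c: "c \<in> carrier C"
  shows "counit C (translate \<phi> c) = \<phi> c"
proof -
  have bal: "balanced A C C C (\<lambda>x y. counit C x \<odot>\<^bsub>C\<^esub> y)"
    by (rule balancedI) (simp_all add: counit_closed counit_rsmult additive_mapD(2)[OF counit_additive]
        lsmult_closed lsmult_add lsmult_add_scalar lsmult_assoc)
  have "counit C (contract \<phi> w) = \<phi> (tensor_lift C (\<lambda>x y. counit C x \<odot>\<^bsub>C\<^esub> y) w)"
    if "w \<in> carrier CC.T" for w
    by (rule CC.tensor_additive_eqI[OF abelian_A
          additive_map_compose[OF contract_additive[OF \<phi>] counit_additive]
          additive_map_compose[OF CC.tensor_lift_additive[OF abelian_C bal] left_dualD(2)[OF \<phi>]] _ that])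
      (simp add: contract_tens \<phi> CC.tensor_lift_tens[OF abelian_C bal] counit_closed counit_rsmult
        left_dualD[OF \<phi>])
  then show ?thesis
    using counit_left[OF c] comult_closed[OF c] by (simp add: translate_def)
qed

text \<open>
  Being right \<open>A\<close>-linear on the left dual thus means to commute with right multiplication of values. In this form
  linearity is compared with a dual basis expansion below.
\<close>
lemma left_dual_mult_map:
  assumes "\<phi> \<in> carrier LD" "a \<in> carrier A"
  shows "\<phi> \<otimes>\<^bsub>LD\<^esub> left_dual_map A C a = (\<lambda>c\<in>carrier C. \<phi> c \<otimes>\<^bsub>A\<^esub> a)"
  using assms by (simp add: left_dual_simps left_dual_map_def translate_closed counit_translate cong: restrict_cong)

lemma abelian_group_left_dual: "abelian_group LD"
proof (rule abelian_groupI)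
  show "\<zero>\<^bsub>LD\<^esub> \<in> carrier LD"
    unfolding left_dual_simps by (rule left_dual_restrictI[OF additive_mapI]) simp_all
  show "\<exists>\<psi>\<in>carrier LD. \<psi> \<oplus>\<^bsub>LD\<^esub> \<phi> = \<zero>\<^bsub>LD\<^esub>" if \<phi>: "\<phi> \<in> carrier LD" for \<phi>
  proof
    show "(\<lambda>c\<in>carrier C. \<ominus>\<^bsub>A\<^esub> \<phi> c) \<in> carrier LD"
      by (rule left_dual_restrictI[OF additive_mapI])
        (simp_all add: left_dualD[OF \<phi>] R.minus_add R.r_minus)
    show "(\<lambda>c\<in>carrier C. \<ominus>\<^bsub>A\<^esub> \<phi> c) \<oplus>\<^bsub>LD\<^esub> \<phi> = \<zero>\<^bsub>LD\<^esub>"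
      by (simp add: left_dual_simps left_dualD[OF \<phi>] R.l_neg cong: restrict_cong)
  qed
  fix \<phi> \<psi> \<chi> assume \<phi>: "\<phi> \<in> carrier LD" and \<psi>: "\<psi> \<in> carrier LD" and \<chi>: "\<chi> \<in> carrier LD"
  show "\<phi> \<oplus>\<^bsub>LD\<^esub> \<psi> \<in> carrier LD"
    by (rule left_dual_add_closed[OF \<phi> \<psi>])
  show "(\<phi> \<oplus>\<^bsub>LD\<^esub> \<psi>) \<oplus>\<^bsub>LD\<^esub> \<chi> = \<phi> \<oplus>\<^bsub>LD\<^esub> (\<psi> \<oplus>\<^bsub>LD\<^esub> \<chi>)"
    by (simp add: left_dual_simps left_dualD[OF \<phi>] left_dualD[OF \<psi>] left_dualD[OF \<chi>] R.a_assoc cong: restrict_cong)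
next
  fix \<phi> \<psi> assume \<phi>: "\<phi> \<in> carrier LD" and \<psi>: "\<psi> \<in> carrier LD"
  show "\<phi> \<oplus>\<^bsub>LD\<^esub> \<psi> = \<psi> \<oplus>\<^bsub>LD\<^esub> \<phi>"
    by (simp add: left_dual_simps left_dualD[OF \<phi>] left_dualD[OF \<psi>] R.a_comm cong: restrict_cong)
next
  fix \<phi> assume \<phi>: "\<phi> \<in> carrier LD"
  show "\<zero>\<^bsub>LD\<^esub> \<oplus>\<^bsub>LD\<^esub> \<phi> = \<phi>"
    using left_dualD(1)[OF \<phi>]
    by (simp add: left_dual_simps left_dualD[OF \<phi>] extensional_restrict cong: restrict_cong)
qed

lemma ring_left_dual: "ring LD"
proof (rule ringI[OF abelian_group_left_dual])
  show "monoid LD"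
  proof (rule monoidI)
    fix \<phi> \<psi> \<chi> assume \<phi>: "\<phi> \<in> carrier LD" and \<psi>: "\<psi> \<in> carrier LD" and \<chi>: "\<chi> \<in> carrier LD"
    show "(\<phi> \<otimes>\<^bsub>LD\<^esub> \<psi>) \<otimes>\<^bsub>LD\<^esub> \<chi> = \<phi> \<otimes>\<^bsub>LD\<^esub> (\<psi> \<otimes>\<^bsub>LD\<^esub> \<chi>)"
    proof -
      have "((\<phi> \<otimes>\<^bsub>LD\<^esub> \<psi>) \<otimes>\<^bsub>LD\<^esub> \<chi>) c = (\<phi> \<otimes>\<^bsub>LD\<^esub> (\<psi> \<otimes>\<^bsub>LD\<^esub> \<chi>)) c" if "c \<in> carrier C" for c
        using that translate_mult[OF \<phi> \<psi> that] translate_closed[OF \<phi> that]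
        by (simp add: left_dual_apply)
      then show ?thesis
        by (intro left_dual_eqI left_dual_mult_closed \<phi> \<psi> \<chi>)
    qed
  next
    fix \<phi> assume \<phi>: "\<phi> \<in> carrier LD"
    show "\<phi> \<otimes>\<^bsub>LD\<^esub> \<one>\<^bsub>LD\<^esub> = \<phi>"
      by (rule left_dual_eqI[OF left_dual_mult_closed])
       (simp_all add: \<phi> left_dual_one_closed, simp add: left_dual_simps translate_closed \<phi> counit_translate)
    show "\<one>\<^bsub>LD\<^esub> \<otimes>\<^bsub>LD\<^esub> \<phi> = \<phi>"
      by (rule left_dual_eqI[OF left_dual_mult_closed])
       (simp_all add: \<phi> left_dual_one_closed, simp add: left_dual_simps(4) translate_one)
  qed (simp_all add: left_dual_mult_closed left_dual_one_closed)
next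
  fix \<phi> \<psi> \<chi> assume \<phi>: "\<phi> \<in> carrier LD" and \<psi>: "\<psi> \<in> carrier LD" and \<chi>: "\<chi> \<in> carrier LD"
  have "((\<phi> \<oplus>\<^bsub>LD\<^esub> \<psi>) \<otimes>\<^bsub>LD\<^esub> \<chi>) c = (\<phi> \<otimes>\<^bsub>LD\<^esub> \<chi> \<oplus>\<^bsub>LD\<^esub> \<psi> \<otimes>\<^bsub>LD\<^esub> \<chi>) c"
    if "c \<in> carrier C" for c
    using that translate_add[OF \<phi> \<psi> that] translate_closed[OF \<phi> that] translate_closed[OF \<psi> that]
    by (simp add: left_dual_apply left_dualD(4)[OF \<chi>])
  then show "(\<phi> \<oplus>\<^bsub>LD\<^esub> \<psi>) \<otimes>\<^bsub>LD\<^esub> \<chi> = \<phi> \<otimes>\<^bsub>LD\<^esub> \<chi> \<oplus>\<^bsub>LD\<^esub> \<psi> \<otimes>\<^bsub>LD\<^esub> \<chi>"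
    by (intro left_dual_eqI left_dual_mult_closed left_dual_add_closed \<phi> \<psi> \<chi>)
  show "\<chi> \<otimes>\<^bsub>LD\<^esub> (\<phi> \<oplus>\<^bsub>LD\<^esub> \<psi>) = \<chi> \<otimes>\<^bsub>LD\<^esub> \<phi> \<oplus>\<^bsub>LD\<^esub> \<chi> \<otimes>\<^bsub>LD\<^esub> \<psi>"
    by (simp add: left_dual_simps translate_closed \<chi> cong: restrict_cong)
qed

lemma left_dual_map_hom: "left_dual_map A C \<in> ring_hom A LD"
proof (rule ring_hom_memI)
  fix a b assume a: "a \<in> carrier A" and b: "b \<in> carrier A"
  show "left_dual_map A C (a \<otimes>\<^bsub>A\<^esub> b) = left_dual_map A C a \<otimes>\<^bsub>LD\<^esub> left_dual_map A C b"
    unfolding left_dual_mult_map[OF left_dual_map_closed[OF a] b]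
    by (simp add: left_dual_map_def counit_closed a b R.m_assoc cong: restrict_cong)
  show "left_dual_map A C (a \<oplus>\<^bsub>A\<^esub> b) = left_dual_map A C a \<oplus>\<^bsub>LD\<^esub> left_dual_map A C b"
    by (simp add: left_dual_simps left_dual_map_def counit_closed a b R.r_distr cong: restrict_cong)
qed (simp_all add: left_dual_map_closed left_dual_map_one)

end

section \<open>Dual bases of finitely generated projective modules\<close>

lemma left_module_free:
  assumes "ring R"
  shows "left_module R (free_left_module R I)"
proof -
  interpret ring R by fact
  let ?F = "free_left_module R I"
  have ag: "abelian_group ?F"
  proof (rule abelian_groupI)
    fix v w assume v: "v \<in> carrier ?F" and w: "w \<in> carrier ?F"
    have "finite {i \<in> I. v i \<oplus>\<^bsub>R\<^esub> w i \<noteq> \<zero>\<^bsub>R\<^esub>}"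
    proof (rule finite_subset)
      show "{i \<in> I. v i \<oplus>\<^bsub>R\<^esub> w i \<noteq> \<zero>\<^bsub>R\<^esub>} \<subseteq> {i \<in> I. v i \<noteq> \<zero>\<^bsub>R\<^esub>} \<union> {i \<in> I. w i \<noteq> \<zero>\<^bsub>R\<^esub>}"
        by auto
    qed (use v w in \<open>auto simp: free_left_module_def\<close>)
    moreover have "{i \<in> I. (\<lambda>i\<in>I. v i \<oplus>\<^bsub>R\<^esub> w i) i \<noteq> \<zero>\<^bsub>R\<^esub>} = {i \<in> I. v i \<oplus>\<^bsub>R\<^esub> w i \<noteq> \<zero>\<^bsub>R\<^esub>}"
      by auto
    ultimately show "v \<oplus>\<^bsub>?F\<^esub> w \<in> carrier ?F"
      using v w by (auto simp: free_left_module_def PiE_iff)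
    show "v \<oplus>\<^bsub>?F\<^esub> w = w \<oplus>\<^bsub>?F\<^esub> v"
      using v w by (auto simp: free_left_module_def PiE_iff a_comm)
  next
    fix u v w assume "u \<in> carrier ?F" "v \<in> carrier ?F" "w \<in> carrier ?F"
    then show "(u \<oplus>\<^bsub>?F\<^esub> v) \<oplus>\<^bsub>?F\<^esub> w = u \<oplus>\<^bsub>?F\<^esub> (v \<oplus>\<^bsub>?F\<^esub> w)"
      by (auto simp: free_left_module_def PiE_iff a_assoc)
  next
    have "{i \<in> I. (\<lambda>i\<in>I. \<zero>\<^bsub>R\<^esub>) i \<noteq> \<zero>\<^bsub>R\<^esub>} = {}" by auto
    then show "\<zero>\<^bsub>?F\<^esub> \<in> carrier ?F"
      by (auto simp: free_left_module_def)
  next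
    fix v assume v: "v \<in> carrier ?F"
    then have v': "v i \<in> carrier R" if "i \<in> I" for i
      using that by (auto simp: free_left_module_def)
    show "\<zero>\<^bsub>?F\<^esub> \<oplus>\<^bsub>?F\<^esub> v = v"
      using v by (auto simp: free_left_module_def PiE_iff extensional_def fun_eq_iff)
    have "{i \<in> I. (\<lambda>i\<in>I. \<ominus>\<^bsub>R\<^esub> v i) i \<noteq> \<zero>\<^bsub>R\<^esub>} \<subseteq> {i \<in> I. v i \<noteq> \<zero>\<^bsub>R\<^esub>}"
      by auto
    moreover have "finite {i \<in> I. v i \<noteq> \<zero>\<^bsub>R\<^esub>}"
      using v by (simp add: free_left_module_def)
    ultimately have "finite {i \<in> I. (\<lambda>i\<in>I. \<ominus>\<^bsub>R\<^esub> v i) i \<noteq> \<zero>\<^bsub>R\<^esub>}"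
      by (rule finite_subset)
    then have "(\<lambda>i\<in>I. \<ominus>\<^bsub>R\<^esub> v i) \<in> carrier ?F"
      using v' by (simp add: free_left_module_def)
    moreover have "(\<lambda>i\<in>I. \<ominus>\<^bsub>R\<^esub> v i) \<oplus>\<^bsub>?F\<^esub> v = \<zero>\<^bsub>?F\<^esub>"
      using v' by (auto simp: free_left_module_def l_neg)
    ultimately show "\<exists>w\<in>carrier ?F. w \<oplus>\<^bsub>?F\<^esub> v = \<zero>\<^bsub>?F\<^esub>" by blast
  qed
  have smult: "a \<odot>\<^bsub>?F\<^esub> v \<in> carrier ?F" if a: "a \<in> carrier R" and v: "v \<in> carrier ?F" for a v
  proof -
    have "{i \<in> I. (\<lambda>i\<in>I. a \<otimes>\<^bsub>R\<^esub> v i) i \<noteq> \<zero>\<^bsub>R\<^esub>} \<subseteq> {i \<in> I. v i \<noteq> \<zero>\<^bsub>R\<^esub>}"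
      using a by auto
    moreover have "finite {i \<in> I. v i \<noteq> \<zero>\<^bsub>R\<^esub>}"
      using v by (simp add: free_left_module_def)
    ultimately have "finite {i \<in> I. (\<lambda>i\<in>I. a \<otimes>\<^bsub>R\<^esub> v i) i \<noteq> \<zero>\<^bsub>R\<^esub>}"
      by (rule finite_subset)
    then show ?thesis
      using a v by (simp add: free_left_module_def PiE_iff)
  qed
  show ?thesis
    unfolding left_module_def left_module_axioms_def
  proof (intro conjI allI impI)
    fix a x assume "a \<in> carrier R" "x \<in> carrier ?F"
    then show "a \<odot>\<^bsub>?F\<^esub> x \<in> carrier ?F" by (rule smult)
  next
    fix a b x assume "a \<in> carrier R" "b \<in> carrier R" "x \<in> carrier ?F"
    then show "(a \<oplus>\<^bsub>R\<^esub> b) \<odot>\<^bsub>?F\<^esub> x = a \<odot>\<^bsub>?F\<^esub> x \<oplus>\<^bsub>?F\<^esub> b \<odot>\<^bsub>?F\<^esub> x"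
      by (auto simp: free_left_module_def PiE_iff l_distr)
  next
    fix a x y assume "a \<in> carrier R" "x \<in> carrier ?F" "y \<in> carrier ?F"
    then show "a \<odot>\<^bsub>?F\<^esub> (x \<oplus>\<^bsub>?F\<^esub> y) = a \<odot>\<^bsub>?F\<^esub> x \<oplus>\<^bsub>?F\<^esub> a \<odot>\<^bsub>?F\<^esub> y"
      by (auto simp: free_left_module_def PiE_iff r_distr)
  next
    fix a b x assume "a \<in> carrier R" "b \<in> carrier R" "x \<in> carrier ?F"
    then show "(a \<otimes>\<^bsub>R\<^esub> b) \<odot>\<^bsub>?F\<^esub> x = a \<odot>\<^bsub>?F\<^esub> (b \<odot>\<^bsub>?F\<^esub> x)"
      by (auto simp: free_left_module_def PiE_iff m_assoc)
  next
    fix x assume "x \<in> carrier ?F"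
    then show "\<one>\<^bsub>R\<^esub> \<odot>\<^bsub>?F\<^esub> x = x"
      by (auto simp: free_left_module_def PiE_iff extensional_def fun_eq_iff)
  qed (use ag \<open>ring R\<close> in auto)
qed

lemma additive_coordinate:
  "i \<in> I \<Longrightarrow> additive_map (free_left_module R I) R (\<lambda>v. v i)"
  by (auto simp: additive_map_def free_left_module_def)

definition unit_vector where
  "unit_vector R I i = (\<lambda>j\<in>I. if j = i then \<one>\<^bsub>R\<^esub> else \<zero>\<^bsub>R\<^esub>)"

lemma unit_vector_closed: "ring R \<Longrightarrow> unit_vector R I i \<in> carrier (free_left_module R I)"
proof -
  assume "ring R"
  then interpret ring R .
  have "{j \<in> I. unit_vector R I i j \<noteq> \<zero>\<^bsub>R\<^esub>} \<subseteq> {i}"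
    by (auto simp: unit_vector_def)
  then have "finite {j \<in> I. unit_vector R I i j \<noteq> \<zero>\<^bsub>R\<^esub>}"
    by (rule finite_subset) simp
  then show ?thesis
    by (simp add: free_left_module_def PiE_iff) (simp add: unit_vector_def)
qed

lemma free_left_module_expansion:
  assumes R: "ring R" and v: "v \<in> carrier (free_left_module R I)"
    and J: "finite J" "J \<subseteq> I" and supp: "\<And>i. i \<in> I - J \<Longrightarrow> v i = \<zero>\<^bsub>R\<^esub>"
  shows "v = (\<Oplus>\<^bsub>free_left_module R I\<^esub>i\<in>J. v i \<odot>\<^bsub>free_left_module R I\<^esub> unit_vector R I i)"
    (is "v = ?s")
proof -
  let ?F = "free_left_module R I"
  interpret left_module R ?F by (rule left_module_free[OF R])
  have vi: "v i \<in> carrier R" if "i \<in> I" for i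
    using v that by (auto simp: free_left_module_def)
  have summand: "(\<lambda>i. v i \<odot>\<^bsub>?F\<^esub> unit_vector R I i) \<in> J \<rightarrow> carrier ?F"
    using vi J by (auto intro!: lsmult_closed unit_vector_closed R)
  have s: "?s \<in> carrier ?F"
    by (rule M.finsum_closed[OF summand])
  have "?s j = v j" if j: "j \<in> I" for j
  proof -
    have "?s j = (\<Oplus>\<^bsub>R\<^esub>i\<in>J. (v i \<odot>\<^bsub>?F\<^esub> unit_vector R I i) j)"
      by (rule additive_map_finsum[OF M.abelian_group_axioms R.abelian_group_axioms
            additive_coordinate[OF j] J(1) summand])
    also have "\<dots> = (\<Oplus>\<^bsub>R\<^esub>i\<in>J. if j = i then v i else \<zero>\<^bsub>R\<^esub>)"
      using J(2) vi by (intro R.finsum_cong') (auto simp: free_left_module_def unit_vector_def j)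
    also have "\<dots> = v j"
    proof (cases "j \<in> J")
      case True
      then show ?thesis
        using J vi by (intro R.finsum_singleton) auto
    next
      case False
      then have "(\<Oplus>\<^bsub>R\<^esub>i\<in>J. if j = i then v i else \<zero>\<^bsub>R\<^esub>) = (\<Oplus>\<^bsub>R\<^esub>i\<in>J. \<zero>\<^bsub>R\<^esub>)"
        by (intro R.finsum_cong') auto
      then show ?thesis
        using False j supp by simp
    qed
    finally show ?thesis .
  qed
  moreover have "v \<in> extensional I" "?s \<in> extensional I"
    using v s by (auto simp: free_left_module_def PiE_def)
  ultimately show ?thesis
    by (intro extensionalityI[of v I ?s]) simp_all
qed

lemma submodule_finsum_closed:
  assumes M: "abelian_group M" and Q: "submodule Q R M" and I: "finite I" and q: "q \<in> I \<rightarrow> Q"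
  shows "(\<Oplus>\<^bsub>M\<^esub>i\<in>I. q i) \<in> Q"
proof -
  interpret M: abelian_group M by fact
  interpret Q: submodule Q R M by fact
  have sub: "Q \<subseteq> carrier M" using Q.subset by simp
  show ?thesis
    using I q
  proof (induction I rule: finite_induct)
    case empty
    then show ?case using Q.one_closed by simp
  next
    case (insert i I)
    have "q \<in> I \<rightarrow> carrier M" "q i \<in> carrier M"
      using insert.prems sub by auto
    then show ?case
      using insert Q.m_closed[of "q i" "finsum M q I"] by simp
  qed
qed

text \<open>
  Let \<open>h\<close> embed \<open>M\<close> in a free module as a summand with complement \<open>Q\<close>. The functionals are the
  coordinates of \<open>h\<close>. Only the finitely many coordinates that occur in images of the generators are ever
  nonzero, and \<open>J\<close> collects these. The vector \<open>e i\<close> is the preimage of the component in \<open>h(M)\<close> of the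
  \<open>i\<close>-th unit vector. Expanding \<open>h x\<close> in unit vectors then yields \<open>h x = h (\<Sum> \<xi> i x \<odot> e i) + p\<close> with \<open>p\<close> in
  \<open>Q\<close>; as \<open>p\<close> also lies in \<open>h(M)\<close>, it vanishes, and \<open>h\<close> is injective.
\<close>
lemma dual_basis:
  fixes R :: "('a, 'e) ring_scheme" and M :: "('a, 'm, 'f) module_scheme"
  assumes "left_module R M" "finitely_generated R M" "projective_left_module R M"
  obtains J :: "'m set" and e \<xi> where "finite J" "e \<in> J \<rightarrow> carrier M"
    and "\<And>i. i \<in> J \<Longrightarrow> additive_map M R (\<xi> i)"
    and "\<And>i a x. \<lbrakk>i \<in> J; a \<in> carrier R; x \<in> carrier M\<rbrakk> \<Longrightarrow> \<xi> i (a \<odot>\<^bsub>M\<^esub> x) = a \<otimes>\<^bsub>R\<^esub> \<xi> i x"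
    and "\<And>x. x \<in> carrier M \<Longrightarrow> x = (\<Oplus>\<^bsub>M\<^esub>i\<in>J. \<xi> i x \<odot>\<^bsub>M\<^esub> e i)"
proof -
  interpret left_module R M by fact
  have R: "ring R" and M: "abelian_group M" by unfold_locales
  obtain Z where Z: "finite Z" "Z \<subseteq> carrier M"
    and gen: "\<And>m. m \<in> carrier M \<Longrightarrow> \<exists>r\<in>Z \<rightarrow> carrier R. m = (\<Oplus>\<^bsub>M\<^esub>x\<in>Z. r x \<odot>\<^bsub>M\<^esub> x)"
    using assms(2) unfolding finitely_generated_def by blast
  obtain I :: "'m set" and P h where P: "direct_summand R P (free_left_module R I)"
    and h: "left_linear R M (free_left_module R I) h" and bij: "bij_betw h (carrier M) P"
    using assms(3) unfolding projective_left_module_def by blast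
  let ?F = "free_left_module R I"
  interpret F: left_module R ?F by (rule left_module_free[OF R])
  have F: "abelian_group ?F" by unfold_locales
  obtain Q where subP: "submodule P R ?F" and subQ: "submodule Q R ?F"
    and int: "P \<inter> Q = {\<zero>\<^bsub>?F\<^esub>}" and dec: "\<And>x. x \<in> carrier ?F \<Longrightarrow> \<exists>p\<in>P. \<exists>q\<in>Q. x = p \<oplus>\<^bsub>?F\<^esub> q"
    using P unfolding direct_summand_def by blast
  interpret P: submodule P R ?F by (rule subP)
  interpret Q: submodule Q R ?F by (rule subQ)
  have PF: "P \<subseteq> carrier ?F" and QF: "Q \<subseteq> carrier ?F"
    using P.subset Q.subset by simp_all
  have h_add: "additive_map M ?F h"
    and h_smult: "\<And>a x. \<lbrakk>a \<in> carrier R; x \<in> carrier M\<rbrakk> \<Longrightarrow> h (a \<odot>\<^bsub>M\<^esub> x) = a \<odot>\<^bsub>?F\<^esub> h x"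
    using h by (auto simp: left_linear_def)
  note h_closed = additive_mapD(1)[OF h_add]
  have h_coord: "h x i \<in> carrier R" if "x \<in> carrier M" "i \<in> I" for x i
    using h_closed[OF that(1)] that(2) by (auto simp: free_left_module_def)
  define J where "J = (\<Union>z\<in>Z. {i \<in> I. h z i \<noteq> \<zero>\<^bsub>R\<^esub>})"
  have J: "finite J" "J \<subseteq> I"
    using Z h_closed by (auto simp: J_def free_left_module_def)
  have supp: "h x i = \<zero>\<^bsub>R\<^esub>" if x: "x \<in> carrier M" and i: "i \<in> I - J" for x i
  proof -
    obtain r where r: "r \<in> Z \<rightarrow> carrier R" "x = (\<Oplus>\<^bsub>M\<^esub>z\<in>Z. r z \<odot>\<^bsub>M\<^esub> z)"
      using gen[OF x] by blast
    have "h x i = (\<Oplus>\<^bsub>R\<^esub>z\<in>Z. h (r z \<odot>\<^bsub>M\<^esub> z) i)"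
      unfolding r(2)
      by (rule additive_map_finsum[OF M R.abelian_group_axioms
            additive_map_compose[OF h_add additive_coordinate] Z(1)])
        (use i r(1) Z(2) in \<open>auto intro!: lsmult_closed\<close>)
    also have "\<dots> = (\<Oplus>\<^bsub>R\<^esub>z\<in>Z. \<zero>\<^bsub>R\<^esub>)"
    proof (intro R.finsum_cong' refl)
      fix z assume z: "z \<in> Z"
      then have "h z i = \<zero>\<^bsub>R\<^esub>" "z \<in> carrier M" "r z \<in> carrier R"
        using i Z(2) r(1) by (auto simp: J_def)
      then show "h (r z \<odot>\<^bsub>M\<^esub> z) i = \<zero>\<^bsub>R\<^esub>"
        using i by (simp add: h_smult) (simp add: free_left_module_def)
    qed simp
    finally show ?thesis by simp
  qed
  have "\<exists>x q. x \<in> carrier M \<and> q \<in> Q \<and> unit_vector R I i = h x \<oplus>\<^bsub>?F\<^esub> q" for i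
  proof -
    obtain p q where "p \<in> P" "q \<in> Q" "unit_vector R I i = p \<oplus>\<^bsub>?F\<^esub> q"
      using dec[OF unit_vector_closed[OF R]] by blast
    moreover obtain x where "x \<in> carrier M" "p = h x"
      using \<open>p \<in> P\<close> bij_betw_imp_surj_on[OF bij] by blast
    ultimately show ?thesis by blast
  qed
  then obtain e q where e: "\<And>i. e i \<in> carrier M" and q: "\<And>i. q i \<in> Q"
    and eq: "\<And>i. unit_vector R I i = h (e i) \<oplus>\<^bsub>?F\<^esub> q i"
    by metis
  have main: "x = (\<Oplus>\<^bsub>M\<^esub>i\<in>J. h x i \<odot>\<^bsub>M\<^esub> e i)" (is "x = ?s") if x: "x \<in> carrier M" for x
  proof -
    have hx: "h x i \<in> carrier R" if "i \<in> J" for i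
      using h_coord[OF x] J that by auto
    have summand: "(\<lambda>i. h x i \<odot>\<^bsub>M\<^esub> e i) \<in> J \<rightarrow> carrier M"
      using hx e by (auto intro!: lsmult_closed)
    then have s: "?s \<in> carrier M" by (rule M.finsum_closed)
    let ?q = "\<Oplus>\<^bsub>?F\<^esub>i\<in>J. h x i \<odot>\<^bsub>?F\<^esub> q i"
    have qQ: "?q \<in> Q"
      by (rule submodule_finsum_closed[OF F subQ J(1)]) (use hx q in \<open>auto intro!: Q.smult_closed\<close>)
    have qF: "q i \<in> carrier ?F" for i
      using q QF by blast
    have "h x = (\<Oplus>\<^bsub>?F\<^esub>i\<in>J. h x i \<odot>\<^bsub>?F\<^esub> unit_vector R I i)"
      by (rule free_left_module_expansion[OF R h_closed[OF x] J supp[OF x]])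
    also have "\<dots> = (\<Oplus>\<^bsub>?F\<^esub>i\<in>J. h (h x i \<odot>\<^bsub>M\<^esub> e i) \<oplus>\<^bsub>?F\<^esub> h x i \<odot>\<^bsub>?F\<^esub> q i)"
      by (rule F.finsum_cong')
        (use hx e qF in \<open>auto simp: eq F.lsmult_add h_smult h_closed F.lsmult_closed\<close>)
    also have "\<dots> = (\<Oplus>\<^bsub>?F\<^esub>i\<in>J. h (h x i \<odot>\<^bsub>M\<^esub> e i)) \<oplus>\<^bsub>?F\<^esub> ?q"
      by (rule F.finsum_addf) (use hx e qF in \<open>auto intro!: h_closed lsmult_closed F.lsmult_closed\<close>)
    also have "(\<Oplus>\<^bsub>?F\<^esub>i\<in>J. h (h x i \<odot>\<^bsub>M\<^esub> e i)) = h ?s"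
      by (rule additive_map_finsum[OF M F h_add J(1) summand, symmetric])
    finally obtain p where p: "p \<in> Q" and hx_eq: "h x = h ?s \<oplus>\<^bsub>?F\<^esub> p"
      using qQ by blast
    have hP: "h x \<in> P" "h ?s \<in> P"
      using bij_betwE[OF bij] x s by blast+
    have "p = \<ominus>\<^bsub>?F\<^esub> h ?s \<oplus>\<^bsub>?F\<^esub> h x"
      using F.r_neg1[OF h_closed[OF s] subsetD[OF QF p]] unfolding hx_eq[symmetric] by (rule sym)
    moreover have "\<ominus>\<^bsub>?F\<^esub> h ?s \<in> P"
      using P.m_inv_closed[OF hP(2)] by (simp add: a_inv_def)
    ultimately have "p \<in> P"
      using P.m_closed[of "\<ominus>\<^bsub>?F\<^esub> h ?s" "h x"] hP(1) by simp
    then have "p = \<zero>\<^bsub>?F\<^esub>"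
      using p int by blast
    then have "h x = h ?s"
      using hx_eq F.r_zero[OF h_closed[OF s]] by metis
    then show ?thesis
      using inj_onD[OF bij_betw_imp_inj_on[OF bij] _ x s] by simp
  qed
  show thesis
  proof (rule that[of J e "\<lambda>i x. h x i"])
    show "finite J" "e \<in> J \<rightarrow> carrier M" using J e by auto
    show "additive_map M R (\<lambda>x. h x i)" if "i \<in> J" for i
      using additive_map_compose[OF h_add additive_coordinate] J that by blast
    show "h (a \<odot>\<^bsub>M\<^esub> x) i = a \<otimes>\<^bsub>R\<^esub> h x i" if "i \<in> J" "a \<in> carrier R" "x \<in> carrier M" for i a x
      using that J by (simp add: h_smult) (auto simp: free_left_module_def)
  qed (rule main)
qed

section \<open>The right dual of a canonical coring\<close>

locale ring_extension = B: ring B + R: ring R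
    for B :: "('b, 'e) ring_scheme" and R :: "('r, 'f) ring_scheme" +
  fixes f :: "'b \<Rightarrow> 'r"
  assumes hom: "f \<in> ring_hom B R"
begin

abbreviation "canonical \<equiv> canonical_coring B f R"
abbreviation "canonical_dual \<equiv> right_dual R canonical"

lemma abelian_R: "abelian_group R"
  by unfold_locales

lemma f_closed: "b \<in> carrier B \<Longrightarrow> f b \<in> carrier R"
  by (rule ring_hom_closed[OF hom])

sublocale RR: tensor_product R B R "ring_bimodule (\<lambda>r. r) f R" "ring_bimodule f (\<lambda>r. r) R"
  by (rule tensor_product.intro; rule bimodule_ring_bimodule)
    (use hom in \<open>auto simp: ring_hom_def B.ring_axioms R.ring_axioms\<close>)

lemmas bimodule_RR = RR.bimodule_T
lemmas abelian_RR = RR.abelian_group_T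

sublocale RR_RR: tensor_product R R R RR.T RR.T
  by (rule tensor_product.intro[OF bimodule_RR bimodule_RR])

lemma canonical_simps:
  "carrier canonical = carrier RR.T" "add canonical = add RR.T" "\<zero>\<^bsub>canonical\<^esub> = \<zero>\<^bsub>RR.T\<^esub>"
  "smult canonical = smult RR.T" "rsmult canonical = rsmult RR.T"
  "comult canonical = tensor_lift RR_RR.T (\<lambda>a b. RR_RR.t (RR.t a \<one>\<^bsub>R\<^esub>) (RR.t \<one>\<^bsub>R\<^esub> b))"
  "counit canonical = tensor_lift R (\<lambda>a b. a \<otimes>\<^bsub>R\<^esub> b)"
  by (simp_all add: canonical_coring_def canonical_tensor_def canonical_tens_def[abs_def] Let_def)

lemma tens_closed: "\<lbrakk>a \<in> carrier R; b \<in> carrier R\<rbrakk> \<Longrightarrow> RR.t a b \<in> carrier RR.T"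
  by (rule RR.tens_closed) simp_all

lemma tens_balance: "\<lbrakk>a \<in> carrier R; x \<in> carrier B; b \<in> carrier R\<rbrakk> \<Longrightarrow>
    RR.t (a \<otimes>\<^bsub>R\<^esub> f x) b = RR.t a (f x \<otimes>\<^bsub>R\<^esub> b)"
  using RR.tens_balance[of a x b] by simp

lemma smult_tens: "\<lbrakk>r \<in> carrier R; a \<in> carrier R; b \<in> carrier R\<rbrakk> \<Longrightarrow>
    r \<odot>\<^bsub>RR.T\<^esub> RR.t a b = RR.t (r \<otimes>\<^bsub>R\<^esub> a) b"
  using RR.smult_tens[of r a b] by simp

lemma rsmult_tens: "\<lbrakk>r \<in> carrier R; a \<in> carrier R; b \<in> carrier R\<rbrakk> \<Longrightarrow>
    RR.t a b \<bullet>\<^bsub>RR.T\<^esub> r = RR.t a (b \<otimes>\<^bsub>R\<^esub> r)"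
  using RR.rsmult_tens[of r a b] by simp

lemma tens_add:
  "\<lbrakk>a \<in> carrier R; a' \<in> carrier R; b \<in> carrier R\<rbrakk> \<Longrightarrow> RR.t (a \<oplus>\<^bsub>R\<^esub> a') b = RR.t a b \<oplus>\<^bsub>RR.T\<^esub> RR.t a' b"
  "\<lbrakk>a \<in> carrier R; b \<in> carrier R; b' \<in> carrier R\<rbrakk> \<Longrightarrow> RR.t a (b \<oplus>\<^bsub>R\<^esub> b') = RR.t a b \<oplus>\<^bsub>RR.T\<^esub> RR.t a b'"
  using RR.tens_add_left[of a a' b] RR.tens_add_right[of a b b'] by simp_all

text \<open>
  \<open>a f(x) \<otimes> 1 = (a \<otimes> 1) f(x)\<close> in \<open>R \<otimes>\<^sub>B R\<close>, so \<open>f(x)\<close> can be moved across the outer tensor product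
  over \<open>R\<close>.
\<close>
lemma balanced_comult:
  "balanced B (ring_bimodule (\<lambda>r. r) f R) (ring_bimodule f (\<lambda>r. r) R) RR_RR.T
     (\<lambda>a b. RR_RR.t (RR.t a \<one>\<^bsub>R\<^esub>) (RR.t \<one>\<^bsub>R\<^esub> b))"
proof (rule balancedI)
  fix m x n assume m: "m \<in> carrier (ring_bimodule (\<lambda>r. r) f R)" and x: "x \<in> carrier B"
    and n: "n \<in> carrier (ring_bimodule f (\<lambda>r. r) R)"
  have "RR_RR.t (RR.t (m \<otimes>\<^bsub>R\<^esub> f x) \<one>\<^bsub>R\<^esub>) (RR.t \<one>\<^bsub>R\<^esub> n) =
      RR_RR.t (RR.t m \<one>\<^bsub>R\<^esub> \<bullet>\<^bsub>RR.T\<^esub> f x) (RR.t \<one>\<^bsub>R\<^esub> n)"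
    using m x n by (simp add: tens_balance rsmult_tens f_closed)
  also have "\<dots> = RR_RR.t (RR.t m \<one>\<^bsub>R\<^esub>) (f x \<odot>\<^bsub>RR.T\<^esub> RR.t \<one>\<^bsub>R\<^esub> n)"
    using m x n by (intro RR_RR.tens_balance) (simp_all add: tens_closed f_closed)
  also have "f x \<odot>\<^bsub>RR.T\<^esub> RR.t \<one>\<^bsub>R\<^esub> n = RR.t \<one>\<^bsub>R\<^esub> (f x \<otimes>\<^bsub>R\<^esub> n)"
    using n x tens_balance[of "\<one>\<^bsub>R\<^esub>" x n] by (simp add: smult_tens f_closed)
  finally show "RR_RR.t (RR.t (m \<bullet>\<^bsub>ring_bimodule (\<lambda>r. r) f R\<^esub> x) \<one>\<^bsub>R\<^esub>) (RR.t \<one>\<^bsub>R\<^esub> n) =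
      RR_RR.t (RR.t m \<one>\<^bsub>R\<^esub>) (RR.t \<one>\<^bsub>R\<^esub> (x \<odot>\<^bsub>ring_bimodule f (\<lambda>r. r) R\<^esub> n))"
    by simp
qed (simp_all add: tens_closed tens_add RR_RR.tens_closed RR_RR.tens_add_left RR_RR.tens_add_right)

lemma comult_additive: "additive_map RR.T RR_RR.T (comult canonical)"
  unfolding canonical_simps
  by (rule RR.tensor_lift_additive[OF RR_RR.abelian_group_T balanced_comult])

lemma comult_tens:
  assumes "a \<in> carrier R" "b \<in> carrier R"
  shows "comult canonical (RR.t a b) = RR_RR.t (RR.t a \<one>\<^bsub>R\<^esub>) (RR.t \<one>\<^bsub>R\<^esub> b)"
  unfolding canonical_simps
  by (rule RR.tensor_lift_tens[OF RR_RR.abelian_group_T balanced_comult]) (use assms in simp_all)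

lemma balanced_extension:
  assumes g: "additive_map R R g"
    and lin: "\<And>r x. \<lbrakk>r \<in> carrier R; x \<in> carrier B\<rbrakk> \<Longrightarrow> g (r \<otimes>\<^bsub>R\<^esub> f x) = g r \<otimes>\<^bsub>R\<^esub> f x"
  shows "balanced B (ring_bimodule (\<lambda>r. r) f R) (ring_bimodule f (\<lambda>r. r) R) R (\<lambda>a b. g a \<otimes>\<^bsub>R\<^esub> b)"
  by (rule balancedI) (simp_all add: additive_mapD[OF g] R.l_distr R.r_distr lin f_closed R.m_assoc)

lemma canonical_dual_carrier: "\<Phi> \<in> carrier canonical_dual \<longleftrightarrow> \<Phi> \<in> extensional (carrier RR.T) \<and>
    additive_map RR.T R \<Phi> \<and> (\<forall>u\<in>carrier RR.T. \<forall>r\<in>carrier R. \<Phi> (u \<bullet>\<^bsub>RR.T\<^esub> r) = \<Phi> u \<otimes>\<^bsub>R\<^esub> r)"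
  by (simp add: right_dual_def right_Hom_def right_linear_def additive_map_def canonical_simps)

lemma canonical_dual_restrictI:
  assumes "additive_map RR.T R g"
    and "\<And>r u. \<lbrakk>r \<in> carrier R; u \<in> carrier RR.T\<rbrakk> \<Longrightarrow> g (u \<bullet>\<^bsub>RR.T\<^esub> r) = g u \<otimes>\<^bsub>R\<^esub> r"
  shows "restrict g (carrier RR.T) \<in> carrier canonical_dual"
  unfolding canonical_dual_carrier using assms bimodule.rsmult_closed[OF bimodule_RR]
  by (auto simp: additive_map_def)

lemma additive_rmult: "r \<in> carrier R \<Longrightarrow> additive_map R R (\<lambda>s. s \<otimes>\<^bsub>R\<^esub> r)"
  by (rule additive_mapI) (simp_all add: R.l_distr)

lemma canonical_dualD:
  assumes "\<Phi> \<in> carrier canonical_dual"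
  shows "\<Phi> \<in> extensional (carrier RR.T)" "additive_map RR.T R \<Phi>"
    and "u \<in> carrier RR.T \<Longrightarrow> \<Phi> u \<in> carrier R"
    and "\<lbrakk>u \<in> carrier RR.T; r \<in> carrier R\<rbrakk> \<Longrightarrow> \<Phi> (u \<bullet>\<^bsub>RR.T\<^esub> r) = \<Phi> u \<otimes>\<^bsub>R\<^esub> r"
  using assms by (auto simp: canonical_dual_carrier additive_map_def)

text \<open>
  A right \<open>R\<close>-linear map \<open>\<Phi>\<close> on \<open>R \<otimes>\<^sub>B R\<close> is determined by \<open>r \<mapsto> \<Phi>(r \<otimes> 1)\<close>, since
  \<open>\<Phi>(a \<otimes> b) = \<Phi>(a \<otimes> 1) b\<close>. The lemmas below show that this assignment is a ring isomorphism from the right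
  dual onto the ring of right \<open>B\<close>-linear endomorphisms of \<open>R\<close>, with composition as product.
\<close>
definition left_slice :: "(('r \<times> 'r \<Rightarrow>\<^sub>0 int) set \<Rightarrow> 'r) \<Rightarrow> 'r \<Rightarrow> 'r" where
  "left_slice \<Phi> r = \<Phi> (RR.t r \<one>\<^bsub>R\<^esub>)"

lemma left_slice_closed: "\<lbrakk>\<Phi> \<in> carrier canonical_dual; r \<in> carrier R\<rbrakk> \<Longrightarrow> left_slice \<Phi> r \<in> carrier R"
  by (simp add: left_slice_def canonical_dualD(3) tens_closed)

lemma left_slice_additive: "\<Phi> \<in> carrier canonical_dual \<Longrightarrow> additive_map R R (left_slice \<Phi>)"
  by (rule additive_mapI)
    (simp_all add: left_slice_closed, simp add: left_slice_def tens_add additive_mapD(2)[OF canonical_dualD(2)] tens_closed)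

lemma canonical_dual_tens:
  assumes "\<Phi> \<in> carrier canonical_dual" "a \<in> carrier R" "b \<in> carrier R"
  shows "\<Phi> (RR.t a b) = left_slice \<Phi> a \<otimes>\<^bsub>R\<^esub> b"
  using canonical_dualD(4)[OF assms(1), of "RR.t a \<one>\<^bsub>R\<^esub>" b] assms
  by (simp add: left_slice_def rsmult_tens tens_closed)

lemma left_slice_right_linear:
  assumes "\<Phi> \<in> carrier canonical_dual" "r \<in> carrier R" "x \<in> carrier B"
  shows "left_slice \<Phi> (r \<otimes>\<^bsub>R\<^esub> f x) = left_slice \<Phi> r \<otimes>\<^bsub>R\<^esub> f x"
  using canonical_dual_tens[OF assms(1,2) f_closed[OF assms(3)]] assms(2,3)
  by (simp add: left_slice_def tens_balance f_closed)

lemma canonical_dual_eqI: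
  assumes "\<Phi> \<in> carrier canonical_dual" "\<Psi> \<in> carrier canonical_dual"
    and "\<And>r. r \<in> carrier R \<Longrightarrow> left_slice \<Phi> r = left_slice \<Psi> r"
  shows "\<Phi> = \<Psi>"
proof (rule extensionalityI[OF canonical_dualD(1)[OF assms(1)] canonical_dualD(1)[OF assms(2)]])
  show "\<Phi> u = \<Psi> u" if "u \<in> carrier RR.T" for u
    by (rule RR.tensor_additive_eqI[OF abelian_R canonical_dualD(2)[OF assms(1)]
          canonical_dualD(2)[OF assms(2)] _ that])
      (simp add: canonical_dual_tens assms)
qed

text \<open>
  Surjectivity: a right \<open>B\<close>-linear \<open>g\<close> is the slice of \<open>a \<otimes> b \<mapsto> g(a) b\<close>.
\<close>
lemma
  assumes g: "additive_map R R g"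
    and lin: "\<And>r x. \<lbrakk>r \<in> carrier R; x \<in> carrier B\<rbrakk> \<Longrightarrow> g (r \<otimes>\<^bsub>R\<^esub> f x) = g r \<otimes>\<^bsub>R\<^esub> f x"
  shows extension_closed:
      "restrict (tensor_lift R (\<lambda>a b. g a \<otimes>\<^bsub>R\<^esub> b)) (carrier RR.T) \<in> carrier canonical_dual"
      (is "restrict ?l _ \<in> _")
    and left_slice_extension: "r \<in> carrier R \<Longrightarrow>
      left_slice (restrict (tensor_lift R (\<lambda>a b. g a \<otimes>\<^bsub>R\<^esub> b)) (carrier RR.T)) r = g r"
proof -
  note bal = balanced_extension[OF g lin]
  have l_add: "additive_map RR.T R ?l"
    by (rule RR.tensor_lift_additive[OF abelian_R bal])
  have l_tens: "?l (RR.t a b) = g a \<otimes>\<^bsub>R\<^esub> b" if "a \<in> carrier R" "b \<in> carrier R" for a b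
    by (rule RR.tensor_lift_tens[OF abelian_R bal]) (use that in simp_all)
  have "?l (u \<bullet>\<^bsub>RR.T\<^esub> r) = ?l u \<otimes>\<^bsub>R\<^esub> r" if r: "r \<in> carrier R" and u: "u \<in> carrier RR.T" for u r
    by (rule RR.tensor_additive_eqI[OF abelian_R additive_map_compose[OF RR.additive_rsmult[OF r] l_add]
          additive_map_compose[OF l_add additive_rmult[OF r]] _ u])
      (simp add: r rsmult_tens l_tens R.m_assoc additive_mapD(1)[OF g])
  then show "restrict ?l (carrier RR.T) \<in> carrier canonical_dual"
    by (rule canonical_dual_restrictI[OF l_add])
  show "left_slice (restrict ?l (carrier RR.T)) r = g r" if "r \<in> carrier R"
    using that by (simp add: left_slice_def tens_closed l_tens additive_mapD(1)[OF g])
qed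

lemma canonical_dual_simps:
  "\<Phi> \<oplus>\<^bsub>canonical_dual\<^esub> \<Psi> = (\<lambda>u\<in>carrier RR.T. \<Phi> u \<oplus>\<^bsub>R\<^esub> \<Psi> u)"
  "\<one>\<^bsub>canonical_dual\<^esub> = restrict (counit canonical) (carrier RR.T)"
  "\<Phi> \<otimes>\<^bsub>canonical_dual\<^esub> \<Psi> = (\<lambda>u\<in>carrier RR.T.
     \<Phi> (tensor_lift RR.T (\<lambda>x y. \<Psi> x \<odot>\<^bsub>RR.T\<^esub> y) (comult canonical u)))"
proof -
  have "tensor_lift canonical g = tensor_lift RR.T g"
      for g :: "('r \<times> 'r \<Rightarrow>\<^sub>0 int) set \<Rightarrow> ('r \<times> 'r \<Rightarrow>\<^sub>0 int) set \<Rightarrow> _"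
    by (rule tensor_lift_cong_additive) (simp_all add: canonical_simps)
  then show "\<Phi> \<otimes>\<^bsub>canonical_dual\<^esub> \<Psi> = (\<lambda>u\<in>carrier RR.T.
     \<Phi> (tensor_lift RR.T (\<lambda>x y. \<Psi> x \<odot>\<^bsub>RR.T\<^esub> y) (comult canonical u)))"
    by (simp add: right_dual_def canonical_simps(1,4))
qed (simp_all add: right_dual_def canonical_simps(1))

lemma left_slice_add: "r \<in> carrier R \<Longrightarrow> left_slice (\<Phi> \<oplus>\<^bsub>canonical_dual\<^esub> \<Psi>) r = left_slice \<Phi> r \<oplus>\<^bsub>R\<^esub> left_slice \<Psi> r"
  by (simp add: canonical_dual_simps left_slice_def tens_closed)

lemma
  shows canonical_dual_one_closed: "\<one>\<^bsub>canonical_dual\<^esub> \<in> carrier canonical_dual"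
    and left_slice_one: "r \<in> carrier R \<Longrightarrow> left_slice \<one>\<^bsub>canonical_dual\<^esub> r = r"
  unfolding canonical_dual_simps canonical_simps
  by (rule extension_closed left_slice_extension; simp add: additive_map_id)+

lemma canonical_dual_add_closed:
  assumes \<Phi>: "\<Phi> \<in> carrier canonical_dual" and \<Psi>: "\<Psi> \<in> carrier canonical_dual"
  shows "\<Phi> \<oplus>\<^bsub>canonical_dual\<^esub> \<Psi> \<in> carrier canonical_dual"
  unfolding canonical_dual_simps
  by (rule canonical_dual_restrictI[OF additive_map_add[OF abelian_R]])
    (simp_all add: canonical_dualD[OF \<Phi>] canonical_dualD[OF \<Psi>] R.l_distr)

text \<open>
  \<open>(\<Phi> * \<Psi>)(a \<otimes> b) = \<Phi>(\<Psi>(a \<otimes> 1) (1 \<otimes> b)) = \<Phi>(\<Psi>(a \<otimes> 1) \<otimes> b)\<close>, by \<open>\<Delta>(a \<otimes> b) = (a \<otimes> 1) \<otimes> (1 \<otimes> b)\<close>.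
\<close>
lemma
  assumes \<Phi>: "\<Phi> \<in> carrier canonical_dual" and \<Psi>: "\<Psi> \<in> carrier canonical_dual"
  shows canonical_dual_mult_closed: "\<Phi> \<otimes>\<^bsub>canonical_dual\<^esub> \<Psi> \<in> carrier canonical_dual"
    and left_slice_mult: "r \<in> carrier R \<Longrightarrow> left_slice (\<Phi> \<otimes>\<^bsub>canonical_dual\<^esub> \<Psi>) r = left_slice \<Phi> (left_slice \<Psi> r)"
proof -
  have bal: "balanced R RR.T RR.T RR.T (\<lambda>x y. \<Psi> x \<odot>\<^bsub>RR.T\<^esub> y)"
    by (rule balancedI) (simp_all add: canonical_dualD(3,4)[OF \<Psi>] additive_mapD(2)[OF canonical_dualD(2)[OF \<Psi>]]
        RR_RR.left.lsmult_closed RR_RR.left.lsmult_add RR_RR.left.lsmult_add_scalar RR_RR.left.lsmult_assoc)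
  define p where "p u = \<Phi> (tensor_lift RR.T (\<lambda>x y. \<Psi> x \<odot>\<^bsub>RR.T\<^esub> y) (comult canonical u))" for u
  have p_add: "additive_map RR.T R p"
    unfolding p_def[abs_def]
    by (rule additive_map_compose[OF additive_map_compose[OF comult_additive
            RR_RR.tensor_lift_additive[OF abelian_RR bal]] canonical_dualD(2)[OF \<Phi>]])
  have p_tens: "p (RR.t a b) = left_slice \<Phi> (left_slice \<Psi> a) \<otimes>\<^bsub>R\<^esub> b" if "a \<in> carrier R" "b \<in> carrier R" for a b
  proof -
    have "tensor_lift RR.T (\<lambda>x y. \<Psi> x \<odot>\<^bsub>RR.T\<^esub> y) (comult canonical (RR.t a b)) = RR.t (left_slice \<Psi> a) b"
      using that RR_RR.tensor_lift_tens[OF abelian_RR bal, of "RR.t a \<one>\<^bsub>R\<^esub>" "RR.t \<one>\<^bsub>R\<^esub> b"]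
        left_slice_closed[OF \<Psi> that(1)]
      by (simp add: comult_tens tens_closed canonical_dual_tens[OF \<Psi>] smult_tens)
    then show ?thesis
      using that by (simp add: p_def canonical_dual_tens[OF \<Phi>] left_slice_closed[OF \<Psi>])
  qed
  have mult: "\<Phi> \<otimes>\<^bsub>canonical_dual\<^esub> \<Psi> = restrict p (carrier RR.T)"
    by (simp add: canonical_dual_simps p_def[abs_def])
  have "p (u \<bullet>\<^bsub>RR.T\<^esub> r) = p u \<otimes>\<^bsub>R\<^esub> r" if r: "r \<in> carrier R" and u: "u \<in> carrier RR.T" for u r
    by (rule RR.tensor_additive_eqI[OF abelian_R additive_map_compose[OF RR.additive_rsmult[OF r] p_add]
          additive_map_compose[OF p_add additive_rmult[OF r]] _ u])
      (simp add: r rsmult_tens p_tens R.m_assoc left_slice_closed \<Phi> \<Psi>)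
  then show "\<Phi> \<otimes>\<^bsub>canonical_dual\<^esub> \<Psi> \<in> carrier canonical_dual"
    unfolding mult by (rule canonical_dual_restrictI[OF p_add])
  show "left_slice (\<Phi> \<otimes>\<^bsub>canonical_dual\<^esub> \<Psi>) r = left_slice \<Phi> (left_slice \<Psi> r)" if "r \<in> carrier R"
    using that by (simp add: mult left_slice_def[of "restrict p _"] tens_closed p_tens left_slice_closed \<Phi> \<Psi>)
qed

end

section \<open>Endomorphisms of a coring with a finite dual basis\<close>

locale coring_dual_basis = coring A C
    for A :: "('a, 'e) ring_scheme" and C :: "('a, 'c, 'f) coring_scheme" +
  fixes J :: "'j set" and e :: "'j \<Rightarrow> 'c" and \<xi> :: "'j \<Rightarrow> 'c \<Rightarrow> 'a"
  assumes finite_J: "finite J"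
    and e_closed: "j \<in> J \<Longrightarrow> e j \<in> carrier C"
    and functional_additive: "j \<in> J \<Longrightarrow> additive_map C A (\<xi> j)"
    and functional_lsmult:
      "\<lbrakk>j \<in> J; a \<in> carrier A; x \<in> carrier C\<rbrakk> \<Longrightarrow> \<xi> j (a \<odot>\<^bsub>C\<^esub> x) = a \<otimes>\<^bsub>A\<^esub> \<xi> j x"
    and expansion: "x \<in> carrier C \<Longrightarrow> x = (\<Oplus>\<^bsub>C\<^esub>j\<in>J. \<xi> j x \<odot>\<^bsub>C\<^esub> e j)"
begin

sublocale ext: ring_extension A LD "left_dual_map A C"
  by (intro ring_extension.intro ring_extension_axioms.intro ring_A ring_left_dual left_dual_map_hom)

text \<open>Elements of the left dual are extensional, hence the restriction.\<close>
definition \<eta> :: "'j \<Rightarrow> 'c \<Rightarrow> 'a" where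
  "\<eta> j = restrict (\<xi> j) (carrier C)"

lemma \<eta>_closed: "j \<in> J \<Longrightarrow> \<eta> j \<in> carrier LD"
  unfolding \<eta>_def by (intro left_dual_restrictI functional_additive functional_lsmult)

lemma functional_closed: "\<lbrakk>j \<in> J; c \<in> carrier C\<rbrakk> \<Longrightarrow> \<xi> j c \<in> carrier A"
  by (rule additive_mapD(1)[OF functional_additive])

lemma additive_evaluation: "c \<in> carrier C \<Longrightarrow> additive_map LD A (\<lambda>\<phi>. \<phi> c)"
  by (rule additive_mapI) (simp_all add: left_dualD left_dual_apply)

lemma functional_sum:
  assumes \<phi>: "\<phi> \<in> carrier LD" and a: "\<And>j. j \<in> J \<Longrightarrow> a j \<in> carrier A"
  shows "\<phi> (\<Oplus>\<^bsub>C\<^esub>j\<in>J. a j \<odot>\<^bsub>C\<^esub> e j) = (\<Oplus>\<^bsub>A\<^esub>j\<in>J. a j \<otimes>\<^bsub>A\<^esub> \<phi> (e j))"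
proof -
  have "\<phi> (\<Oplus>\<^bsub>C\<^esub>j\<in>J. a j \<odot>\<^bsub>C\<^esub> e j) = (\<Oplus>\<^bsub>A\<^esub>j\<in>J. \<phi> (a j \<odot>\<^bsub>C\<^esub> e j))"
    by (rule additive_map_finsum[OF abelian_C abelian_A left_dualD(2)[OF \<phi>] finite_J])
      (use a e_closed in \<open>auto intro!: lsmult_closed\<close>)
  also have "\<dots> = (\<Oplus>\<^bsub>A\<^esub>j\<in>J. a j \<otimes>\<^bsub>A\<^esub> \<phi> (e j))"
    by (rule R.finsum_cong') (use a e_closed in \<open>auto simp: left_dualD[OF \<phi>]\<close>)
  finally show ?thesis .
qed

lemma functionals_separate:
  assumes x: "x \<in> carrier C" and y: "y \<in> carrier C"
    and eq: "\<And>\<phi>. \<phi> \<in> carrier LD \<Longrightarrow> \<phi> x = \<phi> y"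
  shows "x = y"
proof -
  have "\<xi> j x = \<xi> j y" if "j \<in> J" for j
    using eq[OF \<eta>_closed[OF that]] x y by (simp add: \<eta>_def)
  then have "(\<Oplus>\<^bsub>C\<^esub>j\<in>J. \<xi> j x \<odot>\<^bsub>C\<^esub> e j) = (\<Oplus>\<^bsub>C\<^esub>j\<in>J. \<xi> j y \<odot>\<^bsub>C\<^esub> e j)"
    using e_closed functional_closed[OF _ y] by (intro M.finsum_cong') (auto intro!: lsmult_closed)
  then show ?thesis
    using expansion[OF x] expansion[OF y] by metis
qed

lemma dual_summand:
  assumes "\<phi> \<in> carrier LD"
  shows "(\<lambda>j. \<eta> j \<otimes>\<^bsub>LD\<^esub> left_dual_map A C (\<phi> (e j))) \<in> J \<rightarrow> carrier LD"
  using \<eta>_closed e_closed by (auto intro!: ext.R.m_closed ext.f_closed left_dualD(3)[OF assms])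

text \<open>The functionals generate the left dual as a right \<open>A\<close>-module, with coefficients \<open>\<phi> (e j)\<close>.\<close>
lemma left_dual_expansion:
  assumes \<phi>: "\<phi> \<in> carrier LD"
  shows "\<phi> = (\<Oplus>\<^bsub>LD\<^esub>j\<in>J. \<eta> j \<otimes>\<^bsub>LD\<^esub> left_dual_map A C (\<phi> (e j)))" (is "\<phi> = ?s")
proof -
  have "?s c = \<phi> c" if c: "c \<in> carrier C" for c
  proof -
    have "?s c = (\<Oplus>\<^bsub>A\<^esub>j\<in>J. (\<eta> j \<otimes>\<^bsub>LD\<^esub> left_dual_map A C (\<phi> (e j))) c)"
      by (rule additive_map_finsum[OF abelian_group_left_dual abelian_A additive_evaluation[OF c]
            finite_J dual_summand[OF \<phi>]])
    also have "\<dots> = (\<Oplus>\<^bsub>A\<^esub>j\<in>J. \<xi> j c \<otimes>\<^bsub>A\<^esub> \<phi> (e j))"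
      by (rule R.finsum_cong')
        (use c \<eta>_closed e_closed in \<open>auto simp: left_dual_mult_map left_dualD(3)[OF \<phi>] \<eta>_def
           intro!: functional_closed\<close>)
    also have "\<dots> = \<phi> (\<Oplus>\<^bsub>C\<^esub>j\<in>J. \<xi> j c \<odot>\<^bsub>C\<^esub> e j)"
      by (rule functional_sum[OF \<phi>, symmetric]) (rule functional_closed[OF _ c])
    also have "\<dots> = \<phi> c"
      using expansion[OF c] by simp
    finally show ?thesis .
  qed
  then show ?thesis
    using left_dual_eqI[OF \<phi> ext.R.finsum_closed[OF dual_summand[OF \<phi>]]] by simp
qed

definition dual_to_End :: "((('c \<Rightarrow> 'a) \<times> ('c \<Rightarrow> 'a) \<Rightarrow>\<^sub>0 int) set \<Rightarrow> 'c \<Rightarrow> 'a) \<Rightarrow> 'c \<Rightarrow> 'c" where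
  "dual_to_End \<Phi> = (\<lambda>c\<in>carrier C. \<Oplus>\<^bsub>C\<^esub>j\<in>J. ext.left_slice \<Phi> (\<eta> j) c \<odot>\<^bsub>C\<^esub> e j)"

lemma slice_value_closed:
  "\<lbrakk>\<Phi> \<in> carrier ext.canonical_dual; \<phi> \<in> carrier LD; c \<in> carrier C\<rbrakk>
    \<Longrightarrow> ext.left_slice \<Phi> \<phi> c \<in> carrier A"
  by (rule left_dualD(3)[OF ext.left_slice_closed])

lemma dual_to_End_closed:
  assumes "\<Phi> \<in> carrier ext.canonical_dual" "c \<in> carrier C"
  shows "dual_to_End \<Phi> c \<in> carrier C"
  using assms e_closed slice_value_closed \<eta>_closed unfolding dual_to_End_def
  by (auto intro!: M.finsum_closed lsmult_closed)

text \<open>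
  Expand \<open>\<phi>\<close> in the functionals, and use that \<open>\<Phi>(- \<otimes> 1)\<close> is right \<open>A\<close>-linear. Since functionals separate
  points, this equation characterises \<open>dual_to_End \<Phi>\<close>.
\<close>
lemma functional_dual_to_End:
  assumes \<Phi>: "\<Phi> \<in> carrier ext.canonical_dual" and \<phi>: "\<phi> \<in> carrier LD" and c: "c \<in> carrier C"
  shows "\<phi> (dual_to_End \<Phi> c) = ext.left_slice \<Phi> \<phi> c"
proof -
  let ?i = "left_dual_map A C"
  have "ext.left_slice \<Phi> \<phi> c = ext.left_slice \<Phi> (\<Oplus>\<^bsub>LD\<^esub>j\<in>J. \<eta> j \<otimes>\<^bsub>LD\<^esub> ?i (\<phi> (e j))) c"
    using left_dual_expansion[OF \<phi>] by simp
  also have "\<dots> = (\<Oplus>\<^bsub>A\<^esub>j\<in>J. ext.left_slice \<Phi> (\<eta> j \<otimes>\<^bsub>LD\<^esub> ?i (\<phi> (e j))) c)"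
    by (rule additive_map_finsum[OF abelian_group_left_dual abelian_A
          additive_map_compose[OF ext.left_slice_additive[OF \<Phi>] additive_evaluation[OF c]]
          finite_J dual_summand[OF \<phi>]])
  also have "\<dots> = (\<Oplus>\<^bsub>A\<^esub>j\<in>J. ext.left_slice \<Phi> (\<eta> j) c \<otimes>\<^bsub>A\<^esub> \<phi> (e j))"
  proof (rule R.finsum_cong'[OF refl])
    show "(\<lambda>j. ext.left_slice \<Phi> (\<eta> j) c \<otimes>\<^bsub>A\<^esub> \<phi> (e j)) \<in> J \<rightarrow> carrier A"
      using \<Phi> \<phi> c \<eta>_closed e_closed slice_value_closed left_dualD(3) by auto
    fix j assume j: "j \<in> J"
    note \<phi>e = left_dualD(3)[OF \<phi> e_closed[OF j]]
    show "ext.left_slice \<Phi> (\<eta> j \<otimes>\<^bsub>LD\<^esub> ?i (\<phi> (e j))) c = ext.left_slice \<Phi> (\<eta> j) c \<otimes>\<^bsub>A\<^esub> \<phi> (e j)"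
      using c left_dual_mult_map[OF ext.left_slice_closed[OF \<Phi> \<eta>_closed[OF j]] \<phi>e]
      by (simp add: ext.left_slice_right_linear[OF \<Phi> \<eta>_closed[OF j] \<phi>e])
  qed
  also have "\<dots> = \<phi> (\<Oplus>\<^bsub>C\<^esub>j\<in>J. ext.left_slice \<Phi> (\<eta> j) c \<odot>\<^bsub>C\<^esub> e j)"
    by (rule functional_sum[OF \<phi>, symmetric]) (rule slice_value_closed[OF \<Phi> \<eta>_closed c])
  finally show ?thesis
    using c by (simp add: dual_to_End_def)
qed

lemma dual_to_End_extensional: "dual_to_End \<Phi> \<in> extensional (carrier C)"
  by (simp add: dual_to_End_def)

lemma dual_to_End_eqI:
  assumes \<Phi>: "\<Phi> \<in> carrier ext.canonical_dual"
    and g: "g \<in> extensional (carrier C)" "\<And>c. c \<in> carrier C \<Longrightarrow> g c \<in> carrier C"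
    and eq: "\<And>\<phi> c. \<lbrakk>\<phi> \<in> carrier LD; c \<in> carrier C\<rbrakk> \<Longrightarrow> ext.left_slice \<Phi> \<phi> c = \<phi> (g c)"
  shows "dual_to_End \<Phi> = g"
proof (rule extensionalityI[OF dual_to_End_extensional g(1)])
  show "dual_to_End \<Phi> c = g c" if c: "c \<in> carrier C" for c
    by (rule functionals_separate)
      (use \<Phi> g(2) eq c in \<open>auto simp: dual_to_End_closed functional_dual_to_End\<close>)
qed

lemma dual_to_End_linear:
  assumes \<Phi>: "\<Phi> \<in> carrier ext.canonical_dual"
  shows "dual_to_End \<Phi> \<in> left_Hom A C C"
proof -
  note slice = left_dualD[OF ext.left_slice_closed[OF \<Phi>]]
  have "dual_to_End \<Phi> (x \<oplus>\<^bsub>C\<^esub> y) = dual_to_End \<Phi> x \<oplus>\<^bsub>C\<^esub> dual_to_End \<Phi> y"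
    if "x \<in> carrier C" "y \<in> carrier C" for x y
    by (rule functionals_separate)
      (use \<Phi> that in \<open>simp_all add: dual_to_End_closed functional_dual_to_End left_dualD slice\<close>)
  moreover have "dual_to_End \<Phi> (a \<odot>\<^bsub>C\<^esub> x) = a \<odot>\<^bsub>C\<^esub> dual_to_End \<Phi> x"
    if "a \<in> carrier A" "x \<in> carrier C" for a x
    by (rule functionals_separate)
      (use \<Phi> that in \<open>simp_all add: dual_to_End_closed functional_dual_to_End left_dualD slice
         lsmult_closed\<close>)
  ultimately show ?thesis
    using \<Phi> by (simp add: left_Hom_def left_linear_def additive_map_def dual_to_End_extensional
        dual_to_End_closed)
qed

lemma dual_to_End_inj: "inj_on dual_to_End (carrier ext.canonical_dual)"
proof (rule inj_onI)
  fix \<Phi> \<Psi> assume \<Phi>: "\<Phi> \<in> carrier ext.canonical_dual" and \<Psi>: "\<Psi> \<in> carrier ext.canonical_dual"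
    and eq: "dual_to_End \<Phi> = dual_to_End \<Psi>"
  show "\<Phi> = \<Psi>"
  proof (rule ext.canonical_dual_eqI[OF \<Phi> \<Psi>])
    fix \<phi> assume \<phi>: "\<phi> \<in> carrier LD"
    show "ext.left_slice \<Phi> \<phi> = ext.left_slice \<Psi> \<phi>"
    proof (rule left_dual_eqI[OF ext.left_slice_closed[OF \<Phi> \<phi>] ext.left_slice_closed[OF \<Psi> \<phi>]])
      show "ext.left_slice \<Phi> \<phi> c = ext.left_slice \<Psi> \<phi> c" if "c \<in> carrier C" for c
        using functional_dual_to_End[OF \<Phi> \<phi> that] functional_dual_to_End[OF \<Psi> \<phi> that] eq by simp
    qed
  qed
qed

lemma dual_to_End_surj:
  assumes "g \<in> left_Hom A C C"
  shows "g \<in> dual_to_End ` carrier ext.canonical_dual"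
proof -
  have g_ext: "g \<in> extensional (carrier C)" and g_add: "additive_map C C g"
    and g_lin: "\<And>a x. \<lbrakk>a \<in> carrier A; x \<in> carrier C\<rbrakk> \<Longrightarrow> g (a \<odot>\<^bsub>C\<^esub> x) = a \<odot>\<^bsub>C\<^esub> g x"
    using assms by (auto simp: left_Hom_def left_linear_def)
  note g_closed = additive_mapD(1)[OF g_add]
  \<comment> \<open>The transpose of \<open>g\<close> is right \<open>A\<close>-linear, so it is a slice.\<close>
  define g' where "g' \<phi> = (\<lambda>c\<in>carrier C. \<phi> (g c))" for \<phi> :: "'c \<Rightarrow> 'a"
  have g'_closed: "g' \<phi> \<in> carrier LD" if "\<phi> \<in> carrier LD" for \<phi>
    unfolding g'_def
    by (rule left_dual_restrictI[OF additive_map_compose[OF g_add left_dualD(2)[OF that]]])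
      (simp add: g_lin left_dualD[OF that] g_closed)
  have g'_add: "additive_map LD LD g'"
    by (rule additive_mapI) (simp_all add: g'_closed, auto simp: g'_def left_dual_simps g_closed)
  have g'_lin: "g' (\<phi> \<otimes>\<^bsub>LD\<^esub> left_dual_map A C a) = g' \<phi> \<otimes>\<^bsub>LD\<^esub> left_dual_map A C a"
    if "\<phi> \<in> carrier LD" "a \<in> carrier A" for \<phi> a
    unfolding left_dual_mult_map[OF that] left_dual_mult_map[OF g'_closed[OF that(1)] that(2)]
    by (auto simp: g'_def g_closed)
  obtain \<Phi> where \<Phi>: "\<Phi> \<in> carrier ext.canonical_dual"
    and slice: "\<And>\<phi>. \<phi> \<in> carrier LD \<Longrightarrow> ext.left_slice \<Phi> \<phi> = g' \<phi>"
    using ext.extension_closed[OF g'_add] ext.left_slice_extension[OF g'_add] g'_lin by blast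
  have "dual_to_End \<Phi> = g"
    by (rule dual_to_End_eqI[OF \<Phi> g_ext g_closed]) (simp_all add: slice g'_def)
  then show ?thesis
    using \<Phi> by blast
qed

lemma opposite_End_simps:
  "carrier (opposite_ring (left_End A C)) = left_Hom A C C"
  "f \<otimes>\<^bsub>opposite_ring (left_End A C)\<^esub> g = compose (carrier C) g f"
  "f \<oplus>\<^bsub>opposite_ring (left_End A C)\<^esub> g = (\<lambda>x\<in>carrier C. f x \<oplus>\<^bsub>C\<^esub> g x)"
  "\<one>\<^bsub>opposite_ring (left_End A C)\<^esub> = (\<lambda>x\<in>carrier C. x)"
  by (simp_all add: opposite_ring_def left_End_def)

text \<open>
  Order is reversed because \<open>\<phi>\<close> of the image of \<open>\<Phi> * \<Psi>\<close> at \<open>c\<close> is the slice of \<open>\<Phi>\<close> at the slice of \<open>\<Psi>\<close> at \<open>\<phi>\<close>,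
  so the endomorphism of \<open>\<Phi>\<close> is applied to \<open>c\<close> first.
\<close>
lemma dual_to_End_ring_iso:
  "dual_to_End \<in> ring_iso ext.canonical_dual (opposite_ring (left_End A C))"
proof (rule ring_iso_memI)
  fix \<Phi> \<Psi> assume \<Phi>: "\<Phi> \<in> carrier ext.canonical_dual" and \<Psi>: "\<Psi> \<in> carrier ext.canonical_dual"
  show "dual_to_End (\<Phi> \<otimes>\<^bsub>ext.canonical_dual\<^esub> \<Psi>) =
      dual_to_End \<Phi> \<otimes>\<^bsub>opposite_ring (left_End A C)\<^esub> dual_to_End \<Psi>"
    unfolding opposite_End_simps
    by (rule dual_to_End_eqI[OF ext.canonical_dual_mult_closed[OF \<Phi> \<Psi>]])
      (simp_all add: compose_extensional compose_eq dual_to_End_closed functional_dual_to_End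
        ext.left_slice_mult ext.left_slice_closed \<Phi> \<Psi>)
  show "dual_to_End (\<Phi> \<oplus>\<^bsub>ext.canonical_dual\<^esub> \<Psi>) =
      dual_to_End \<Phi> \<oplus>\<^bsub>opposite_ring (left_End A C)\<^esub> dual_to_End \<Psi>"
    unfolding opposite_End_simps
    by (rule dual_to_End_eqI[OF ext.canonical_dual_add_closed[OF \<Phi> \<Psi>]])
      (simp_all add: dual_to_End_closed functional_dual_to_End ext.left_slice_add left_dual_apply
        left_dualD \<Phi> \<Psi>)
next
  show "dual_to_End \<one>\<^bsub>ext.canonical_dual\<^esub> = \<one>\<^bsub>opposite_ring (left_End A C)\<^esub>"
    unfolding opposite_End_simps
    by (rule dual_to_End_eqI[OF ext.canonical_dual_one_closed]) (simp_all add: ext.left_slice_one)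
  show "bij_betw dual_to_End (carrier ext.canonical_dual) (carrier (opposite_ring (left_End A C)))"
    unfolding bij_betw_def opposite_End_simps
    using dual_to_End_inj dual_to_End_linear dual_to_End_surj by blast
qed (simp add: opposite_End_simps dual_to_End_linear)

end

theorem theorem1p1:
  fixes A :: "('a, 'e) ring_scheme"
    and C :: "('a, 'c, 'f) coring_scheme"
  assumes "ring A"
    and "coring A C"
    and "finitely_generated A C"
    and "projective_left_module A C"
  shows "right_dual (left_dual A C) (canonical_coring A (left_dual_map A C) (left_dual A C))
           \<simeq> opposite_ring (left_End A C)"
proof -
  interpret coring A C by fact
  have "left_module A C" by unfold_locales
  then obtain J :: "'c set" and e \<xi> where basis: "finite J" "e \<in> J \<rightarrow> carrier C"
      "\<And>j. j \<in> J \<Longrightarrow> additive_map C A (\<xi> j)"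
      "\<And>j a x. \<lbrakk>j \<in> J; a \<in> carrier A; x \<in> carrier C\<rbrakk> \<Longrightarrow> \<xi> j (a \<odot>\<^bsub>C\<^esub> x) = a \<otimes>\<^bsub>A\<^esub> \<xi> j x"
      "\<And>x. x \<in> carrier C \<Longrightarrow> x = (\<Oplus>\<^bsub>C\<^esub>j\<in>J. \<xi> j x \<odot>\<^bsub>C\<^esub> e j)"
    using assms(3,4) by (rule dual_basis) blast
  have "coring_dual_basis A C J e \<xi>"
    unfolding coring_dual_basis_def coring_dual_basis_axioms_def
    using assms(2) basis(1,2) by (auto simp: basis(3,4) intro: basis(5))
  then show ?thesis
    unfolding is_ring_iso_def using coring_dual_basis.dual_to_End_ring_iso by blast
qed

end
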